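(* Consider an instance of the maintenance scheduling problem (with or without storage nodes) with optimal value $\varphi^*=\max\{\operatorname{val}(t^* ) : t^*\in X\}$. Let $0=t_0<t_1<\cdots<t_n=T$ be any time discretization of $[0,T]$, and let $\varphi$ be the optimal value of the associated Time Discretized Integer Program (TDIP) defined in the context. Then $\varphi^*\leqslant\varphi$.
   Context: The maintenance scheduling problem. $N=(V,A,s,t)$ is a finite directed network (parallel arcs allowed) with distinct source $s$ and sink $t$; $\delta^{\text{out}}(v)$ and $\delta^{\text{in}}(v)$ are the sets of arcs starting, respectively ending, at $v$. $W\subseteq V\setminus\{s,t\}$ is a set of storage nodes, and $u=(u_x)_{x\in A\cup W}$ are nonnegative capacities (flow per unit time for arcs, stored amount for nodes in $W$). $T>0$ is the time horizon. $A_1\subseteq A$ is the set of arcs with a maintenance job; each $a\in A_1$ has exactly one job, with processing time $p_a>0$, release time $r_a$ and deadline $d_a$, where $0\leqslant r_a\leqslant d_a-p_a$ and $d_a\leqslant T$. A feasible solution is a start time vector $t^*=(t^*_a)_{a\in A_1}\in X:=\prod_{a\in A_1}[r_a,d_a-p_a]$. Value of a solution. Given $t^*\in X$, let $0=\tau_0<\tau_1<\cdots<\tau_m=T$ be the increasing enumeration of the set $\{t^*_a : a\in A_1\}\cup\{t^*_a+p_a : a\in A_1\}\cup\{0,T\}$, and for $a\in A_1$ let $I_a=\{i\in\{1,\dots,m\} : t^*_a<\tau_i\leqslant t^*_a+p_a\}$. Then $\operatorname{val}(t^* )$ is the maximum of $\sum_{i=1}^m\big(\sum_{a\in\delta^{\text{out}}(s)}x_{ai}-\sum_{a\in\delta^{\text{in}}(s)}x_{ai}\big)$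 over all nonnegative reals $x_{ai}$ ($a\in A$, $1\leqslant i\leqslant m$) and $x_{vi}$ ($v\in W$, $0\leqslant i\leqslant m$) satisfying: $\sum_{a\in\delta^{\text{out}}(v)}x_{ai}=\sum_{a\in\delta^{\text{in}}(v)}x_{ai}$ for $v\in V\setminus(W\cup\{s,t\})$, $1\leqslant i\leqslant m$; $\sum_{a\in\delta^{\text{out}}(v)}x_{ai}+x_{vi}=\sum_{a\in\delta^{\text{in}}(v)}x_{ai}+x_{v,i-1}$ for $v\in W$, $1\leqslant i\leqslant m$; $x_{ai}\leqslant(\tau_i-\tau_{i-1})u_a$ for $a\in A\setminus A_1$ and all $i$, and for $a\in A_1$ and $i\notin I_a$; $x_{ai}=0$ for $a\in A_1$, $i\in I_a$; $x_{vi}\leqslant u_v$ for $v\in W$, $0\leqslant i\leqslant m$; $x_{v0}=x_{vm}=0$ for $v\in W$. TDIP for the discretization $0=t_0<\cdots<t_n=T$ (here the $t_i$ are fixed). For $a\in A_1$ let $\mathcal S_a=\{i\in\{1,\dots,n\} : r_a<t_i,\ d_a-p_a\geqslant t_{i-1}\}$ and $\mathcal T_a=\{i\in\{1,\dots,n\} : d_a>t_{i-1},\ r_a<t_i\}$. For $i\in\mathcal S_a$ let $Q_{ai}=\{k\in\mathcal T_a : k\geqslant i,\ t_i+p_a>t_{k-1}\}$. For $i\in\mathcal T_a$ let $P_{ai}=\{k\in\mathcal S_a : t_{k-1}\leqslant t_{i-1}<t_k+p_a\}$ and $P^*_{ai}=\{k\in P_{ai} : \max\{t_{k-1},r_a\}+p_a\geqslant\min\{t_i,d_a\}\}$.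 For $k\in P_{ai}$ let $\mu^+_{aki}=\min\{t_i,d_a,t_k+p_a\}-\max\{t_{i-1},r_a\}$, and let $\mu^-_{aki}$ be - $\max\{0,\min\{t_k,d_a\}-(d_a-p_a)\}$ if $k=i$ (and $i\in\mathcal S_a$); - $\min\{t_i,d_a\}-\max\{t_{i-1},r_a\}$ if $k\in P^*_{ai}\setminus\{i\}$; - $\max\{0,\max\{t_{k-1},r_a\}+p_a-t_{i-1}\}$ if $k\in P_{ai}\setminus(P^*_{ai}\cup\{i\})$. The variables are $x_{ai}\geqslant0$ ($a\in A$, $1\leqslant i\leqslant n$), $x_{vi}\geqslant 0$ ($v\in W$, $0\leqslant i\leqslant n$), $y_{ai}\in\{0,1\}$ ($a\in A_1$, $i\in\mathcal S_a$), $z_{ai}\in[0,1]$ ($a\in A_1$, $i\in\mathcal T_a$). TDIP maximizes $\sum_{i=1}^n\big(\sum_{a\in\delta^{\text{out}}(s)}x_{ai}-\sum_{a\in\delta^{\text{in}}(s)}x_{ai}\big)$ subject to: 1. $\sum_{a\in\delta^{\text{out}}(v)}x_{ai}=\sum_{a\in\delta^{\text{in}}(v)}x_{ai}$ for $v\in V\setminus(W\cup\{s,t\})$, $1\leqslant i\leqslant n$; 2. $\sum_{a\in\delta^{\text{out}}(v)}x_{ai}+x_{vi}=\sum_{a\in\delta^{\text{in}}(v)}x_{ai}+x_{v,i-1}$ for $v\in W$, $1\leqslant i\leqslant n$; 3. $x_{ai}\leqslant(t_i-t_{i-1})u_a$ for $a\in A\setminus A_1$, $1\leqslant i\leqslant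 n$; 4. $x_{vi}\leqslant u_v$ for $v\in W$, $0\leqslant i\leqslant n$, and $x_{v0}=x_{vn}=0$ for $v\in W$; 5. $\sum_{i\in\mathcal S_a}y_{ai}=1$ for $a\in A_1$; 6. $(t_i-t_{i-1})z_{ai}\leqslant\min\{t_i,d_a\}-\max\{t_{i-1},r_a\}$ for $a\in A_1$, $i\in\mathcal T_a$; 7. $\sum_{i\in\mathcal T_a}(t_i-t_{i-1})z_{ai}=p_a$ for $a\in A_1$; 8. $\sum_{k\in Q_{ai}}(t_k-t_{k-1})z_{ak}\geqslant p_a y_{ai}$ for $a\in A_1$, $i\in\mathcal S_a$; 9. $\sum_{k\in P_{ai}}\mu^-_{aki}y_{ak}\leqslant(t_i-t_{i-1})z_{ai}\leqslant\sum_{k\in P_{ai}}\mu^+_{aki}y_{ak}$ for $a\in A_1$, $i\in\mathcal T_a$; 10. $x_{ai}\leqslant(t_i-t_{i-1})(1-z_{ai})u_a$ for $a\in A_1$, $i\in\mathcal T_a$; 11. $x_{ai}\leqslant(t_i-t_{i-1})u_a$ for $a\in A_1$, $i\in\{1,\dots,n\}\setminus\mathcal T_a$. *)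

theory Defs
  imports Complex_Main "HOL-Library.FuncSet" "Graph_Theory.Digraph"
begin

definition is_maximum :: "'c::order set \<Rightarrow> 'c \<Rightarrow> bool" where
  "is_maximum S m \<longleftrightarrow> m \<in> S \<and> (\<forall>v\<in>S. v \<le> m)"

text \<open>
  \<open>GREATEST\<close> is unspecified if there is no greatest element; \<open>is_maximum\<close> expresses that the
  maximum exists.
\<close>

lemma is_maximum_Greatest: "is_maximum S m \<Longrightarrow> (GREATEST v. v \<in> S) = m"
  by (auto simp: is_maximum_def intro: Greatest_equality)

record ('v, 'a) maintenance_problem =
  network :: "('v, 'a) pre_digraph"
  source :: 'v
  sink :: 'v
  storage :: "'v set"
  arc_cap :: "'a \<Rightarrow> real"
  node_cap :: "'v \<Rightarrow> real"
  horizon :: real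
  job_arcs :: "'a set"
  proc_time :: "'a \<Rightarrow> real"
  release :: "'a \<Rightarrow> real"
  deadline :: "'a \<Rightarrow> real"

locale maintenance_instance = fin_digraph "network I"
  for I :: "('v, 'a) maintenance_problem" +
  assumes source_in_verts: "source I \<in> verts (network I)"
    and sink_in_verts: "sink I \<in> verts (network I)"
    and source_neq_sink: "source I \<noteq> sink I"
    and storage_subset: "storage I \<subseteq> verts (network I) - {source I, sink I}"
    and arc_cap_nonneg: "a \<in> arcs (network I) \<Longrightarrow> 0 \<le> arc_cap I a"
    and node_cap_nonneg: "v \<in> storage I \<Longrightarrow> 0 \<le> node_cap I v"
    and horizon_pos: "0 < horizon I"
    and job_arcs_subset: "job_arcs I \<subseteq> arcs (network I)"
    and proc_time_pos: "a \<in> job_arcs I \<Longrightarrow> 0 < proc_time I a"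
    and release_nonneg: "a \<in> job_arcs I \<Longrightarrow> 0 \<le> release I a"
    and job_window: "a \<in> job_arcs I \<Longrightarrow> release I a \<le> deadline I a - proc_time I a"
    and deadline_le_horizon: "a \<in> job_arcs I \<Longrightarrow> deadline I a \<le> horizon I"

definition start_times :: "('v, 'a) maintenance_problem \<Rightarrow> ('a \<Rightarrow> real) set" where
  "start_times I = (\<Pi>\<^sub>E a\<in>job_arcs I. {release I a..deadline I a - proc_time I a})"

text \<open>
  For interval end points \<open>\<theta> 0 < \<dots> < \<theta> m\<close>, \<open>x a i\<close> is the amount of flow on arc \<open>a\<close>
  during the interval from \<open>\<theta> (i - 1)\<close> to \<open>\<theta> i\<close> and \<open>w v i\<close> is the amount stored in \<open>v\<close>
  at time \<open>\<theta> i\<close>. The constraints collected here are those that do not involve the jobs;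
  capacities of arcs with a job are added separately.
\<close>

definition storage_flow ::
  "('v, 'a) maintenance_problem \<Rightarrow> nat \<Rightarrow> (nat \<Rightarrow> real) \<Rightarrow>
    ('a \<Rightarrow> nat \<Rightarrow> real) \<Rightarrow> ('v \<Rightarrow> nat \<Rightarrow> real) \<Rightarrow> bool" where
  "storage_flow I m \<theta> x w \<longleftrightarrow>
    (\<forall>a\<in>arcs (network I). \<forall>i\<in>{1..m}. 0 \<le> x a i) \<and>
    (\<forall>v\<in>storage I. \<forall>i\<in>{0..m}. 0 \<le> w v i) \<and>
    (\<forall>v\<in>verts (network I) - (storage I \<union> {source I, sink I}). \<forall>i\<in>{1..m}.
      (\<Sum>a\<in>out_arcs (network I) v. x a i) = (\<Sum>a\<in>in_arcs (network I) v. x a i)) \<and>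
    (\<forall>v\<in>storage I. \<forall>i\<in>{1..m}.
      (\<Sum>a\<in>out_arcs (network I) v. x a i) + w v i =
      (\<Sum>a\<in>in_arcs (network I) v. x a i) + w v (i - 1)) \<and>
    (\<forall>a\<in>arcs (network I) - job_arcs I. \<forall>i\<in>{1..m}. x a i \<le> (\<theta> i - \<theta> (i - 1)) * arc_cap I a) \<and>
    (\<forall>v\<in>storage I. \<forall>i\<in>{0..m}. w v i \<le> node_cap I v) \<and>
    (\<forall>v\<in>storage I. w v 0 = 0 \<and> w v m = 0)"

definition net_outflow ::
  "('v, 'a) maintenance_problem \<Rightarrow> nat \<Rightarrow> ('a \<Rightarrow> nat \<Rightarrow> real) \<Rightarrow> real" where
  "net_outflow I m x =
    (\<Sum>i=1..m. (\<Sum>a\<in>out_arcs (network I) (source I). x a i) -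
                (\<Sum>a\<in>in_arcs (network I) (source I). x a i))"

definition breakpoints :: "('v, 'a) maintenance_problem \<Rightarrow> ('a \<Rightarrow> real) \<Rightarrow> real set" where
  "breakpoints I ts =
    ts ` job_arcs I \<union> (\<lambda>a. ts a + proc_time I a) ` job_arcs I \<union> {0, horizon I}"

definition num_intervals :: "('v, 'a) maintenance_problem \<Rightarrow> ('a \<Rightarrow> real) \<Rightarrow> nat" where
  "num_intervals I ts = card (breakpoints I ts) - 1"

definition breakpoint :: "('v, 'a) maintenance_problem \<Rightarrow> ('a \<Rightarrow> real) \<Rightarrow> nat \<Rightarrow> real" where
  "breakpoint I ts i = sorted_list_of_set (breakpoints I ts) ! i"

definition outage_intervals ::
  "('v, 'a) maintenance_problem \<Rightarrow> ('a \<Rightarrow> real) \<Rightarrow> 'a \<Rightarrow> nat set" where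
  "outage_intervals I ts a =
    {i\<in>{1..num_intervals I ts}. ts a < breakpoint I ts i \<and> breakpoint I ts i \<le> ts a + proc_time I a}"

definition schedule_flow ::
  "('v, 'a) maintenance_problem \<Rightarrow> ('a \<Rightarrow> real) \<Rightarrow>
    ('a \<Rightarrow> nat \<Rightarrow> real) \<Rightarrow> ('v \<Rightarrow> nat \<Rightarrow> real) \<Rightarrow> bool" where
  "schedule_flow I ts x w \<longleftrightarrow>
    storage_flow I (num_intervals I ts) (breakpoint I ts) x w \<and>
    (\<forall>a\<in>job_arcs I. \<forall>i\<in>{1..num_intervals I ts} - outage_intervals I ts a.
      x a i \<le> (breakpoint I ts i - breakpoint I ts (i - 1)) * arc_cap I a) \<and>
    (\<forall>a\<in>job_arcs I. \<forall>i\<in>outage_intervals I ts a. x a i = 0)"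

definition flow_values :: "('v, 'a) maintenance_problem \<Rightarrow> ('a \<Rightarrow> real) \<Rightarrow> real set" where
  "flow_values I ts = {net_outflow I (num_intervals I ts) x | x w. schedule_flow I ts x w}"

definition val :: "('v, 'a) maintenance_problem \<Rightarrow> ('a \<Rightarrow> real) \<Rightarrow> real" where
  "val I ts = (GREATEST v. v \<in> flow_values I ts)"

definition opt_value :: "('v, 'a) maintenance_problem \<Rightarrow> real" where
  "opt_value I = (GREATEST v. v \<in> val I ` start_times I)"

definition discretization ::
  "('v, 'a) maintenance_problem \<Rightarrow> nat \<Rightarrow> (nat \<Rightarrow> real) \<Rightarrow> bool" where
  "discretization I n t \<longleftrightarrow> t 0 = 0 \<and> t n = horizon I \<and> strict_mono_on {0..n} t"

context
  fixes I :: "('v, 'a) maintenance_problem" and n :: nat and t :: "nat \<Rightarrow> real"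
begin

definition S_set :: "'a \<Rightarrow> nat set" where
  "S_set a = {i\<in>{1..n}. release I a < t i \<and> deadline I a - proc_time I a \<ge> t (i - 1)}"

definition T_set :: "'a \<Rightarrow> nat set" where
  "T_set a = {i\<in>{1..n}. deadline I a > t (i - 1) \<and> release I a < t i}"

definition Q_set :: "'a \<Rightarrow> nat \<Rightarrow> nat set" where
  "Q_set a i = {k\<in>T_set a. k \<ge> i \<and> t i + proc_time I a > t (k - 1)}"

definition P_set :: "'a \<Rightarrow> nat \<Rightarrow> nat set" where
  "P_set a i = {k\<in>S_set a. t (k - 1) \<le> t (i - 1) \<and> t (i - 1) < t k + proc_time I a}"

definition P_star :: "'a \<Rightarrow> nat \<Rightarrow> nat set" where
  "P_star a i =
    {k\<in>P_set a i. max (t (k - 1)) (release I a) + proc_time I a \<ge> min (t i) (deadline I a)}"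

definition mu_plus :: "'a \<Rightarrow> nat \<Rightarrow> nat \<Rightarrow> real" where
  "mu_plus a k i =
    min (t i) (min (deadline I a) (t k + proc_time I a)) - max (t (i - 1)) (release I a)"

text \<open>Only used for \<open>k \<in> P_set a i\<close>, so that \<open>k = i\<close> entails \<open>i \<in> S_set a\<close>.\<close>

definition mu_minus :: "'a \<Rightarrow> nat \<Rightarrow> nat \<Rightarrow> real" where
  "mu_minus a k i =
    (if k = i then max 0 (min (t k) (deadline I a) - (deadline I a - proc_time I a))
     else if k \<in> P_star a i then min (t i) (deadline I a) - max (t (i - 1)) (release I a)
     else max 0 (max (t (k - 1)) (release I a) + proc_time I a - t (i - 1)))"

definition tdip_feasible ::
  "('a \<Rightarrow> nat \<Rightarrow> real) \<Rightarrow> ('v \<Rightarrow> nat \<Rightarrow> real) \<Rightarrow>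
    ('a \<Rightarrow> nat \<Rightarrow> real) \<Rightarrow> ('a \<Rightarrow> nat \<Rightarrow> real) \<Rightarrow> bool" where
  "tdip_feasible x w y z \<longleftrightarrow>
    storage_flow I n t x w \<and>
    (\<forall>a\<in>job_arcs I. \<forall>i\<in>S_set a. y a i \<in> {0, 1}) \<and>
    (\<forall>a\<in>job_arcs I. \<forall>i\<in>T_set a. z a i \<in> {0..1}) \<and>
    (\<forall>a\<in>job_arcs I. (\<Sum>i\<in>S_set a. y a i) = 1) \<and>
    (\<forall>a\<in>job_arcs I. \<forall>i\<in>T_set a.
      (t i - t (i - 1)) * z a i \<le> min (t i) (deadline I a) - max (t (i - 1)) (release I a)) \<and>
    (\<forall>a\<in>job_arcs I. (\<Sum>i\<in>T_set a. (t i - t (i - 1)) * z a i) = proc_time I a) \<and>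
    (\<forall>a\<in>job_arcs I. \<forall>i\<in>S_set a.
      (\<Sum>k\<in>Q_set a i. (t k - t (k - 1)) * z a k) \<ge> proc_time I a * y a i) \<and>
    (\<forall>a\<in>job_arcs I. \<forall>i\<in>T_set a.
      (\<Sum>k\<in>P_set a i. mu_minus a k i * y a k) \<le> (t i - t (i - 1)) * z a i \<and>
      (t i - t (i - 1)) * z a i \<le> (\<Sum>k\<in>P_set a i. mu_plus a k i * y a k)) \<and>
    (\<forall>a\<in>job_arcs I. \<forall>i\<in>T_set a. x a i \<le> (t i - t (i - 1)) * (1 - z a i) * arc_cap I a) \<and>
    (\<forall>a\<in>job_arcs I. \<forall>i\<in>{1..n} - T_set a. x a i \<le> (t i - t (i - 1)) * arc_cap I a)"

definition tdip_values :: "real set" where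
  "tdip_values = {net_outflow I n x | x w y z. tdip_feasible x w y z}"

definition tdip_opt :: real where
  "tdip_opt = (GREATEST v. v \<in> tdip_values)"

end

end

theory Submission
  imports Defs "HOL-Analysis.Analysis"
begin

text \<open>
  The cumulative flow on an arc is a piecewise linear function of time. If the grid on which a flow
  is given contains the start and end times of all jobs, then its increments over the intervals of
  any other grid form a flow on that grid, where the capacity of an arc is multiplied by the time
  during which the arc is available. Regridding an optimal solution onto the discretization yields
  a TDIP solution of the same value: \<open>y\<close> marks the interval in which a job starts and \<open>z\<close> is the
  fraction of an interval occupied by the job.

  Regridding also shows that an optimal start time vector exists. All schedules can be represented
  on grids with the same number of intervals if repeated grid points are allowed. The resulting
  solutions, with the start times and the grid as additional variables, form a compact set.
\<close>

subsection \<open>Piecewise linear interpolation on a grid\<close>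

text \<open>The share of the \<open>i\<close>-th interval that has elapsed by time
  \<open>\<tau>\<close>: 0 before the interval, linear inside it, 1 after it. On an interval of
  length zero it is always 0, since division by zero yields 0.\<close>

definition fraction :: "(nat \<Rightarrow> real) \<Rightarrow> nat \<Rightarrow> real \<Rightarrow> real" where
  "fraction \<theta> i \<tau> = (min \<tau> (\<theta> i) - min \<tau> (\<theta> (i - 1))) / (\<theta> i - \<theta> (i - 1))"

text \<open>If \<open>f i\<close> is spread evenly over the \<open>i\<close>-th interval, this is
  the amount accumulated by time \<open>\<tau>\<close>. An amount placed on an interval of length
  zero is lost, hence the conditions on such intervals below.\<close>

definition cumulative :: "nat \<Rightarrow> (nat \<Rightarrow> real) \<Rightarrow> (nat \<Rightarrow> real) \<Rightarrow> real \<Rightarrow> real" where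
  "cumulative m \<theta> f \<tau> = (\<Sum>i=1..m. f i * fraction \<theta> i \<tau>)"

lemma fraction_mono:
  assumes "\<theta> (i - 1) \<le> \<theta> i" "\<sigma> \<le> \<tau>"
  shows "fraction \<theta> i \<sigma> \<le> fraction \<theta> i \<tau>"
  unfolding fraction_def using assms by (intro divide_right_mono) auto

lemma fraction_bounds:
  assumes "\<theta> (i - 1) \<le> \<theta> i"
  shows "0 \<le> fraction \<theta> i \<tau>" "fraction \<theta> i \<tau> \<le> 1"
proof -
  show "0 \<le> fraction \<theta> i \<tau>"
    unfolding fraction_def using assms by (intro divide_nonneg_nonneg) auto
  have "min \<tau> (\<theta> i) - min \<tau> (\<theta> (i - 1)) \<le> \<theta> i - \<theta> (i - 1)"
    using assms by (auto simp: min_def)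
  then show "fraction \<theta> i \<tau> \<le> 1"
    unfolding fraction_def using assms by (cases "\<theta> i = \<theta> (i - 1)") (auto simp: divide_le_eq_1)
qed

lemma grid_mono:
  fixes \<theta> :: "nat \<Rightarrow> real"
  assumes "\<forall>i\<in>{1..m}. \<theta> (i - 1) \<le> \<theta> i" "i \<le> j" "j \<le> m"
  shows "\<theta> i \<le> \<theta> j"
  using assms(2,3)
proof (induction j rule: dec_induct)
  case (step k)
  have "\<theta> (Suc k - 1) \<le> \<theta> (Suc k)"
    using assms(1) step by (intro bspec[where x="Suc k"]) auto
  with step show ?case by simp
qed simp

text \<open>Each summand is the increment of \<open>F\<close> over the elapsed part of an interval,
  so the sum telescopes. It is applied with the capacity of an arc available up to a given time as
  \<open>F\<close>.\<close>

lemma sum_fraction_telescope: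
  assumes "\<And>i. i \<in> {1..m} \<Longrightarrow> f i * fraction \<theta> i \<tau> = F (min \<tau> (\<theta> i)) - F (min \<tau> (\<theta> (i - 1)))"
  shows "cumulative m \<theta> f \<tau> = F (min \<tau> (\<theta> m)) - (F (min \<tau> (\<theta> 0)) :: real)"
proof -
  have "cumulative m \<theta> f \<tau> = (\<Sum>i=1..m. F (min \<tau> (\<theta> i)) - F (min \<tau> (\<theta> (i - 1))))"
    unfolding cumulative_def by (rule sum.cong) (use assms in auto)
  then show ?thesis
    using sum_telescope''[of 0 m "\<lambda>i. F (min \<tau> (\<theta> i))"] by simp
qed

lemma cumulative_before:
  assumes "\<forall>i\<in>{1..m}. \<theta> (i - 1) \<le> \<theta> i" "\<tau> \<le> \<theta> 0"
  shows "cumulative m \<theta> f \<tau> = 0"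
  unfolding cumulative_def
proof (rule sum.neutral, intro ballI)
  fix i assume i: "i \<in> {1..m}"
  have "\<theta> 0 \<le> \<theta> i" "\<theta> 0 \<le> \<theta> (i - 1)"
    using i by (auto intro!: grid_mono[OF assms(1)])
  with assms(2) show "f i * fraction \<theta> i \<tau> = 0"
    by (simp add: fraction_def min_absorb1)
qed

lemma cumulative_after:
  assumes "\<forall>i\<in>{1..m}. \<theta> (i - 1) \<le> \<theta> i" "\<theta> m \<le> \<tau>"
    and "\<And>i. i \<in> {1..m} \<Longrightarrow> \<theta> i = \<theta> (i - 1) \<Longrightarrow> f i = 0"
  shows "cumulative m \<theta> f \<tau> = (\<Sum>i=1..m. f i)"
  unfolding cumulative_def
proof (rule sum.cong)
  fix i assume i: "i \<in> {1..m}"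
  have "\<theta> i \<le> \<theta> m" "\<theta> (i - 1) \<le> \<theta> m"
    using i by (auto intro!: grid_mono[OF assms(1)])
  with assms(2,3) i show "f i * fraction \<theta> i \<tau> = f i"
    by (cases "\<theta> i = \<theta> (i - 1)") (auto simp add: fraction_def min_absorb2)
qed simp

lemma cumulative_mono:
  assumes "\<forall>i\<in>{1..m}. \<theta> (i - 1) \<le> \<theta> i" "\<sigma> \<le> \<tau>" "\<And>i. i \<in> {1..m} \<Longrightarrow> 0 \<le> f i"
  shows "cumulative m \<theta> f \<sigma> \<le> cumulative m \<theta> f \<tau>"
  unfolding cumulative_def using assms
  by (intro sum_mono mult_left_mono fraction_mono) auto

text \<open>The difference of \<open>g\<close> and \<open>f\<close> is nonnegative, so its
  cumulative function is increasing. This carries capacity bounds from the intervals of one grid to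
  arbitrary time intervals.\<close>

lemma cumulative_increment_mono:
  assumes "\<forall>i\<in>{1..m}. \<theta> (i - 1) \<le> \<theta> i" "\<sigma> \<le> \<tau>" "\<And>i. i \<in> {1..m} \<Longrightarrow> f i \<le> g i"
  shows "cumulative m \<theta> f \<tau> - cumulative m \<theta> f \<sigma> \<le> cumulative m \<theta> g \<tau> - cumulative m \<theta> g \<sigma>"
  using cumulative_mono[OF assms(1,2), of "\<lambda>i. g i - f i"] assms(3)
  by (simp add: cumulative_def left_diff_distrib sum_subtractf)

lemma sum_cumulative:
  "(\<Sum>a\<in>A. cumulative m \<theta> (f a) \<tau>) = cumulative m \<theta> (\<lambda>i. \<Sum>a\<in>A. f a i) \<tau>"
  unfolding cumulative_def by (subst sum.swap) (simp add: sum_distrib_right)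

lemma cumulative_diff:
  "cumulative m \<theta> (\<lambda>i. f i - g i) \<tau> = cumulative m \<theta> f \<tau> - cumulative m \<theta> g \<tau>"
  by (simp add: cumulative_def left_diff_distrib sum_subtractf)

lemma cumulative_cong:
  "(\<And>i. i \<in> {1..m} \<Longrightarrow> f i = g i) \<Longrightarrow> cumulative m \<theta> f \<tau> = cumulative m \<theta> g \<tau>"
  unfolding cumulative_def by (rule sum.cong) auto

text \<open>
  The sum is the piecewise linear interpolation of \<open>f\<close> at \<open>\<tau>\<close>, so it stays in every interval
  that contains the values of \<open>f\<close>.
\<close>

lemma interpolation_in_interval:
  assumes "\<forall>i\<in>{1..m}. \<theta> (i - 1) \<le> \<theta> i"
    and "\<And>i. i \<in> {1..m} \<Longrightarrow> \<theta> i = \<theta> (i - 1) \<Longrightarrow> f i = f (i - 1)"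
    and "\<And>i. i \<le> m \<Longrightarrow> f i \<in> {lo..hi}"
  shows "f 0 + cumulative m \<theta> (\<lambda>i. f i - f (i - 1)) \<tau> \<in> {lo..hi}"
  using assms
proof (induction m)
  case (Suc m)
  let ?D = "\<lambda>i. f i - f (i - 1)"
  have step: "cumulative (Suc m) \<theta> ?D \<tau> =
      cumulative m \<theta> ?D \<tau> + (f (Suc m) - f m) * fraction \<theta> (Suc m) \<tau>"
    by (simp add: cumulative_def)
  have le: "\<theta> m \<le> \<theta> (Suc m)" using Suc.prems(1) by force
  show ?case
  proof (cases "\<tau> \<le> \<theta> m")
    case True
    then have "fraction \<theta> (Suc m) \<tau> = 0"
      using le by (simp add: fraction_def min_absorb1)
    then show ?thesis
      unfolding step using Suc.prems by (simp add: Suc.IH[simplified])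
  next
    case False
    \<comment> \<open>All earlier intervals have elapsed by \<open>\<tau>\<close>, so their
      contribution telescopes and a convex combination of \<open>f m\<close> and
      \<open>f (Suc m)\<close> remains.\<close>
    have "cumulative m \<theta> ?D \<tau> = (\<Sum>i=1..m. ?D i)"
      using Suc.prems False by (intro cumulative_after) auto
    also have "\<dots> = f m - f 0"
      using sum_telescope''[of 0 m f] by simp
    finally have eq: "f 0 + cumulative (Suc m) \<theta> ?D \<tau> =
        (1 - fraction \<theta> (Suc m) \<tau>) * f m + fraction \<theta> (Suc m) \<tau> * f (Suc m)"
      unfolding step by (simp add: algebra_simps)
    have "f m \<in> {lo..hi}" "f (Suc m) \<in> {lo..hi}"
      using Suc.prems(3) by auto
    then show ?thesis
      unfolding eq
      using fraction_bounds[of \<theta> "Suc m" \<tau>] le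
        convexD_alt[of "{lo..hi}" "f m" "f (Suc m)" "fraction \<theta> (Suc m) \<tau>"]
      by auto
  qed
qed (simp add: cumulative_def)

subsection \<open>Flows on time grids\<close>

text \<open>For nonnegative \<open>\<tau>\<close> and \<open>ts a\<close>, the amount of time up to
  \<open>\<tau>\<close> during which the arc is free of its job. Increments of this function also
  measure availability on intervals that a job occupies only in part.\<close>

definition uptime :: "('v, 'a) maintenance_problem \<Rightarrow> ('a \<Rightarrow> real) \<Rightarrow> 'a \<Rightarrow> real \<Rightarrow> real" where
  "uptime I ts a \<tau> =
    (if a \<in> job_arcs I then \<tau> - min (max (\<tau> - ts a) 0) (proc_time I a) else \<tau>)"

text \<open>One capacity bound covers all cases: an increment of \<open>uptime\<close> is 0 on an
  outage and the full length on an interval without outage. Unlike \<open>schedule_flow\<close>, it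
  makes sense on any grid.\<close>

definition timed_flow ::
  "('v, 'a) maintenance_problem \<Rightarrow> ('a \<Rightarrow> real) \<Rightarrow> nat \<Rightarrow> (nat \<Rightarrow> real) \<Rightarrow>
    ('a \<Rightarrow> nat \<Rightarrow> real) \<Rightarrow> ('v \<Rightarrow> nat \<Rightarrow> real) \<Rightarrow> bool" where
  "timed_flow I ts m \<theta> x w \<longleftrightarrow>
    storage_flow I m \<theta> x w \<and>
    (\<forall>a\<in>arcs (network I). \<forall>i\<in>{1..m}.
      x a i \<le> (uptime I ts a (\<theta> i) - uptime I ts a (\<theta> (i - 1))) * arc_cap I a)"

text \<open>
  Grids may contain repeated points: a limit of schedules can make breakpoints collide.
\<close>

definition time_grid :: "('v, 'a) maintenance_problem \<Rightarrow> nat \<Rightarrow> (nat \<Rightarrow> real) \<Rightarrow> bool" where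
  "time_grid I m \<theta> \<longleftrightarrow>
    \<theta> 0 = 0 \<and> \<theta> m = horizon I \<and> (\<forall>i\<in>{1..m}. \<theta> (i - 1) \<le> \<theta> i)"

definition adapted_grid ::
  "('v, 'a) maintenance_problem \<Rightarrow> ('a \<Rightarrow> real) \<Rightarrow> nat \<Rightarrow> (nat \<Rightarrow> real) \<Rightarrow> bool" where
  "adapted_grid I ts m \<theta> \<longleftrightarrow>
    time_grid I m \<theta> \<and>
    (\<forall>a\<in>job_arcs I. (\<exists>i\<in>{0..m}. \<theta> i = ts a) \<and> (\<exists>i\<in>{0..m}. \<theta> i = ts a + proc_time I a))"

lemma time_grid_mono: "time_grid I m \<theta> \<Longrightarrow> i \<le> j \<Longrightarrow> j \<le> m \<Longrightarrow> \<theta> i \<le> \<theta> j"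
  unfolding time_grid_def by (blast intro: grid_mono)

lemma time_grid_bounds: "time_grid I m \<theta> \<Longrightarrow> i \<le> m \<Longrightarrow> 0 \<le> \<theta> i \<and> \<theta> i \<le> horizon I"
  using time_grid_mono[of I m \<theta> 0 i] time_grid_mono[of I m \<theta> i m] by (auto simp: time_grid_def)

text \<open>No grid point lies strictly inside a grid interval, and both ends of the job are grid
  points.\<close>

lemma adapted_grid_interval:
  assumes "adapted_grid I ts m \<theta>" "a \<in> job_arcs I" "i \<in> {1..m}"
  shows "\<theta> i \<le> ts a \<or> ts a + proc_time I a \<le> \<theta> (i - 1) \<or>
    ts a \<le> \<theta> (i - 1) \<and> \<theta> i \<le> ts a + proc_time I a"
proof -
  have split: "\<theta> j \<le> \<theta> (i - 1) \<or> \<theta> i \<le> \<theta> j" if "j \<in> {0..m}" for j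
  proof (cases "j < i")
    case True
    with assms(3) have "j \<le> i - 1" "i - 1 \<le> m" by auto
    then show ?thesis using time_grid_mono[of I m \<theta> j "i - 1"] assms(1) by (simp add: adapted_grid_def)
  next
    case False
    then have "i \<le> j" "j \<le> m" using that by auto
    then show ?thesis using time_grid_mono[of I m \<theta> i j] assms(1) by (simp add: adapted_grid_def)
  qed
  from assms obtain j k where "j \<in> {0..m}" "\<theta> j = ts a" "k \<in> {0..m}" "\<theta> k = ts a + proc_time I a"
    unfolding adapted_grid_def by blast
  with split[of j] split[of k] show ?thesis by auto
qed

text \<open>On each interval of an adapted grid \<open>uptime\<close> has constant slope, 0 during
  the job and 1 otherwise. This provides the hypothesis of
  \<open>sum_fraction_telescope\<close>.\<close>

lemma uptime_piecewise_linear: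
  assumes "adapted_grid I ts m \<theta>" "i \<in> {1..m}" "a \<in> job_arcs I \<Longrightarrow> 0 < proc_time I a"
  shows "(uptime I ts a (\<theta> i) - uptime I ts a (\<theta> (i - 1))) * fraction \<theta> i \<tau> =
    uptime I ts a (min \<tau> (\<theta> i)) - uptime I ts a (min \<tau> (\<theta> (i - 1)))"
proof -
  have le: "\<theta> (i - 1) \<le> \<theta> i" using assms by (auto simp: adapted_grid_def time_grid_def)
  have len: "(\<theta> i - \<theta> (i - 1)) * fraction \<theta> i \<tau> = min \<tau> (\<theta> i) - min \<tau> (\<theta> (i - 1))"
    by (auto simp: fraction_def)
  show ?thesis
  proof (cases "a \<in> job_arcs I")
    case True
    note p = assms(3)[OF True]
    from adapted_grid_interval[OF assms(1) True assms(2)]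
    consider "\<theta> i \<le> ts a \<or> ts a + proc_time I a \<le> \<theta> (i - 1)"
      | "ts a \<le> \<theta> (i - 1)" "\<theta> i \<le> ts a + proc_time I a" by blast
    then show ?thesis
    proof cases
      case 1
      then have "uptime I ts a (\<theta> i) - uptime I ts a (\<theta> (i - 1)) = \<theta> i - \<theta> (i - 1)"
        and "uptime I ts a (min \<tau> (\<theta> i)) - uptime I ts a (min \<tau> (\<theta> (i - 1))) =
          min \<tau> (\<theta> i) - min \<tau> (\<theta> (i - 1))"
        using le p True by (auto simp: uptime_def min_def max_def)
      then show ?thesis using len by simp
    next
      case 2
      then have "uptime I ts a (\<theta> i) - uptime I ts a (\<theta> (i - 1)) = 0"
        and "uptime I ts a (min \<tau> (\<theta> i)) - uptime I ts a (min \<tau> (\<theta> (i - 1))) = 0"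
        using le p True by (auto simp: uptime_def min_def max_def)
      then show ?thesis by simp
    qed
  qed (use len in \<open>simp add: uptime_def\<close>)
qed

context maintenance_instance
begin

lemma start_times_bounds:
  assumes "ts \<in> start_times I" "a \<in> job_arcs I"
  shows "release I a \<le> ts a" "ts a + proc_time I a \<le> deadline I a" "0 \<le> ts a"
    "ts a + proc_time I a \<le> horizon I" "0 < proc_time I a"
proof -
  have "ts a \<in> {release I a..deadline I a - proc_time I a}"
    using assms by (auto simp: start_times_def)
  then show "release I a \<le> ts a" "ts a + proc_time I a \<le> deadline I a"
    "0 \<le> ts a" "ts a + proc_time I a \<le> horizon I" "0 < proc_time I a"
    using release_nonneg[OF assms(2)] deadline_le_horizon[OF assms(2)] proc_time_pos[OF assms(2)]
    by auto
qed

lemma uptime_increment_le: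
  assumes "\<sigma> \<le> \<tau>"
  shows "uptime I ts a \<tau> - uptime I ts a \<sigma> \<le> \<tau> - \<sigma>"
  using assms proc_time_pos[of a] by (auto simp: uptime_def min_def max_def)

text \<open>Conservation passes to the cumulative flows by linearity, stored amounts are
  interpolated, and the capacity bound survives because the old grid is adapted. The new grid need
  not be adapted, which allows a fixed discretization as target. Totals agree because both grids
  span the horizon.\<close>

lemma timed_flow_regrid:
  assumes "adapted_grid I ts m \<theta>" "timed_flow I ts m \<theta> x w" "time_grid I n t"
  obtains x' w' where "timed_flow I ts n t x' w'" "net_outflow I n x' = net_outflow I m x"
proof
  define X where "X a \<tau> = cumulative m \<theta> (x a) \<tau>" for a \<tau>
  define x' where "x' a j = X a (t j) - X a (t (j - 1))" for a j
  \<comment> \<open>The stored amount is the inflow minus the outflow accumulated by time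
    \<open>t j\<close>, so the storage balance on the new grid holds by construction.\<close>
  define w' where "w' v j = (\<Sum>a\<in>in_arcs (network I) v. X a (t j)) -
    (\<Sum>a\<in>out_arcs (network I) v. X a (t j))" for v j
  have grid: "\<forall>i\<in>{1..m}. \<theta> (i - 1) \<le> \<theta> i" "\<theta> 0 = 0" "\<theta> m = horizon I"
    using assms(1) by (auto simp: adapted_grid_def time_grid_def)
  have t_le: "t (j - 1) \<le> t j" if "j \<in> {1..n}" for j
    using assms(3) that by (simp add: time_grid_def)
  have t_bounds: "0 \<le> t j" "t j \<le> horizon I" if "j \<le> n" for j
    using time_grid_bounds[OF assms(3) that] by auto
  have t_ends: "t 0 = 0" "t n = horizon I"
    using assms(3) by (auto simp: time_grid_def)
  have flow: "storage_flow I m \<theta> x w" using assms(2) by (simp add: timed_flow_def)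
  have storage: "(\<Sum>a\<in>out_arcs (network I) v. x a i) + w v i =
    (\<Sum>a\<in>in_arcs (network I) v. x a i) + w v (i - 1)" if "v \<in> storage I" "i \<in> {1..m}" for v i
    using flow that by (simp add: storage_flow_def)
  have cap: "x a i \<le> (uptime I ts a (\<theta> i) - uptime I ts a (\<theta> (i - 1))) * arc_cap I a"
    if "a \<in> arcs (network I)" "i \<in> {1..m}" for a i
    using assms(2) that by (simp add: timed_flow_def)
  have nonneg: "0 \<le> x a i" if "a \<in> arcs (network I)" "i \<in> {1..m}" for a i
    using flow that by (simp add: storage_flow_def)
  \<comment> \<open>On an interval of length zero the increment of \<open>uptime\<close> vanishes,
    so no flow is lost by the cumulative functions.\<close>
  have degenerate: "x a i = 0" if "a \<in> arcs (network I)" "i \<in> {1..m}" "\<theta> i = \<theta> (i - 1)" for a i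
    using cap[OF that(1,2)] nonneg[OF that(1,2)] that(3) by simp
  have sums: "(\<Sum>a\<in>A. x' a j) = (\<Sum>a\<in>A. X a (t j)) - (\<Sum>a\<in>A. X a (t (j - 1)))" for A j
    by (simp add: x'_def sum_subtractf)
  \<comment> \<open>By the old storage balance, the net inflow in an interval is the increment of
    \<open>w v\<close>. Hence \<open>w'\<close> interpolates the old stored amounts and inherits
    their bounds.\<close>
  have w'_eq: "w' v j = cumulative m \<theta> (\<lambda>i. w v i - w v (i - 1)) (t j)" if "v \<in> storage I" for v j
  proof -
    have "w' v j = cumulative m \<theta> (\<lambda>i. (\<Sum>a\<in>in_arcs (network I) v. x a i) -
      (\<Sum>a\<in>out_arcs (network I) v. x a i)) (t j)"
      by (simp add: w'_def X_def sum_cumulative cumulative_diff)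
    also have "\<dots> = cumulative m \<theta> (\<lambda>i. w v i - w v (i - 1)) (t j)"
      using storage[OF that] by (intro cumulative_cong) (simp add: algebra_simps)
    finally show ?thesis .
  qed
  have w'_bounds: "w' v j \<in> {0..node_cap I v}" if v: "v \<in> storage I" for v j
  proof -
    have "w v i = w v (i - 1)" if "i \<in> {1..m}" "\<theta> i = \<theta> (i - 1)" for i
    proof -
      have "(\<Sum>a\<in>out_arcs (network I) v. x a i) = 0" "(\<Sum>a\<in>in_arcs (network I) v. x a i) = 0"
        using degenerate that by (auto intro!: sum.neutral)
      then show ?thesis using storage[OF v that(1)] by simp
    qed
    moreover have "w v i \<in> {0..node_cap I v}" if "i \<le> m" for i
      using flow v that by (simp add: storage_flow_def)
    ultimately have "w v 0 + cumulative m \<theta> (\<lambda>i. w v i - w v (i - 1)) (t j) \<in> {0..node_cap I v}"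
      by (intro interpolation_in_interval grid)
    moreover have "w v 0 = 0" using flow v by (simp add: storage_flow_def)
    ultimately show ?thesis by (simp add: w'_eq[OF v])
  qed
  have w'_ends: "w' v 0 = 0" "w' v n = 0" if v: "v \<in> storage I" for v
  proof -
    have "X a (t 0) = 0" for a
      using grid by (simp add: X_def t_ends cumulative_before)
    then show "w' v 0 = 0" by (simp add: w'_def)
    \<comment> \<open>At the horizon every old interval has elapsed, so the total net inflow
      appears, which telescopes to the difference of the final and initial stored amounts.\<close>
    have "w' v n = (\<Sum>a\<in>in_arcs (network I) v. \<Sum>i=1..m. x a i) -
      (\<Sum>a\<in>out_arcs (network I) v. \<Sum>i=1..m. x a i)"
      unfolding w'_def X_def using degenerate grid
      by (intro arg_cong2[where f="(-)"] sum.cong cumulative_after) (auto simp: t_ends)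
    also have "\<dots> = (\<Sum>i=1..m. (\<Sum>a\<in>in_arcs (network I) v. x a i) -
      (\<Sum>a\<in>out_arcs (network I) v. x a i))"
      by (simp add: sum_subtractf sum.swap[of _ _ "{Suc 0..m}"])
    also have "\<dots> = (\<Sum>i=1..m. w v i - w v (i - 1))"
      using storage[OF v] by (intro sum.cong) (auto simp: algebra_simps)
    also have "\<dots> = w v m - w v 0"
      using sum_telescope''[of 0 m "w v"] by simp
    also have "\<dots> = 0" using flow v by (simp add: storage_flow_def)
    finally show "w' v n = 0" .
  qed
  have x'_cap: "x' a j \<le> (uptime I ts a (t j) - uptime I ts a (t (j - 1))) * arc_cap I a"
    if a: "a \<in> arcs (network I)" and j: "j \<in> {1..n}" for a j
  proof -
    let ?U = "\<lambda>\<tau>. uptime I ts a \<tau> * arc_cap I a"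
    let ?g = "\<lambda>i. ?U (\<theta> i) - ?U (\<theta> (i - 1))"
    \<comment> \<open>Interpolating the increments of \<open>?U\<close> gives back \<open>?U\<close>
      itself, up to the constant \<open>?U 0\<close>. The old bounds thus add up to the increment of
      \<open>?U\<close> between any two points of the new grid.\<close>
    have U: "cumulative m \<theta> ?g (t k) = ?U (t k) - ?U 0" if "k \<le> n" for k
    proof -
      have "?g i * fraction \<theta> i (t k) = ?U (min (t k) (\<theta> i)) - ?U (min (t k) (\<theta> (i - 1)))"
        if "i \<in> {1..m}" for i
        using arg_cong[where f="\<lambda>u. u * arc_cap I a",
            OF uptime_piecewise_linear[OF assms(1) that proc_time_pos, of a "t k"]]
        by (simp add: algebra_simps)
      from sum_fraction_telescope[where F="?U", OF this] show ?thesis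
        using t_bounds[OF that] by (simp add: grid(2,3))
    qed
    have "x' a j \<le> cumulative m \<theta> ?g (t j) - cumulative m \<theta> ?g (t (j - 1))"
      unfolding x'_def X_def using cap[OF a] grid t_le[OF j]
      by (intro cumulative_increment_mono) (auto simp: left_diff_distrib)
    also have "\<dots> = ?U (t j) - ?U (t (j - 1))"
      using U[of j] U[of "j - 1", OF le_trans[OF diff_le_self]] j by auto
    finally show ?thesis by (simp add: left_diff_distrib)
  qed
  show "timed_flow I ts n t x' w'"
    unfolding timed_flow_def storage_flow_def
  proof (intro conjI ballI)
    fix a j assume "a \<in> arcs (network I)" "j \<in> {1..n}"
    then show "0 \<le> x' a j"
      using cumulative_mono[OF grid(1) t_le, of j "x a"] nonneg by (simp add: x'_def X_def)
  next
    fix v j assume "v \<in> verts (network I) - (storage I \<union> {source I, sink I})" "j \<in> {1..n}"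
    then have "cumulative m \<theta> (\<lambda>i. \<Sum>a\<in>out_arcs (network I) v. x a i) \<tau> =
      cumulative m \<theta> (\<lambda>i. \<Sum>a\<in>in_arcs (network I) v. x a i) \<tau>" for \<tau>
      using flow by (intro cumulative_cong) (simp add: storage_flow_def)
    then show "(\<Sum>a\<in>out_arcs (network I) v. x' a j) = (\<Sum>a\<in>in_arcs (network I) v. x' a j)"
      by (simp add: sums X_def sum_cumulative)
  next
    fix v j
    show "(\<Sum>a\<in>out_arcs (network I) v. x' a j) + w' v j =
      (\<Sum>a\<in>in_arcs (network I) v. x' a j) + w' v (j - 1)"
      by (simp add: sums w'_def)
  next
    fix a j assume a: "a \<in> arcs (network I) - job_arcs I" and j: "j \<in> {1..n}"
    then show "x' a j \<le> (t j - t (j - 1)) * arc_cap I a"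
      using x'_cap[of a j] by (simp add: uptime_def)
  qed (use w'_bounds w'_ends x'_cap in auto)
  have total: "(\<Sum>j=1..n. \<Sum>a\<in>A. x' a j) = (\<Sum>i=1..m. \<Sum>a\<in>A. x a i)"
    if "A \<subseteq> arcs (network I)" for A
  proof -
    have "(\<Sum>j=1..n. \<Sum>a\<in>A. x' a j) = (\<Sum>a\<in>A. \<Sum>j=1..n. x' a j)"
      by (rule sum.swap)
    also have "\<dots> = (\<Sum>a\<in>A. \<Sum>i=1..m. x a i)"
    proof (rule sum.cong)
      fix a assume "a \<in> A"
      with that have a: "a \<in> arcs (network I)" by auto
      have "(\<Sum>j=1..n. x' a j) = X a (t n) - X a (t 0)"
        unfolding x'_def using sum_telescope''[of 0 n "\<lambda>j. X a (t j)"] by simp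
      also have "X a (t 0) = 0"
        using grid by (simp add: X_def t_ends cumulative_before)
      also have "X a (t n) = (\<Sum>i=1..m. x a i)"
        unfolding X_def using degenerate[OF a] grid
        by (intro cumulative_after) (auto simp: t_ends)
      finally show "(\<Sum>j=1..n. x' a j) = (\<Sum>i=1..m. x a i)" by simp
    qed simp
    also have "\<dots> = (\<Sum>i=1..m. \<Sum>a\<in>A. x a i)"
      by (rule sum.swap)
    finally show ?thesis .
  qed
  show "net_outflow I n x' = net_outflow I m x"
    unfolding net_outflow_def sum_subtractf
    by (subst (1 2) total) (auto simp: in_arcs_def out_arcs_def)
qed

end

subsection \<open>Compactness and existence of optimal schedules\<close>

lemma closed_Collect_ball:
  "(\<And>a. a \<in> A \<Longrightarrow> closed {p. P a p}) \<Longrightarrow> closed {p. \<forall>a\<in>A. P a p}"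
  by (simp add: Collect_ball_eq closed_INT)

lemma closed_Collect_finite_bex:
  assumes "finite A" "\<And>a. a \<in> A \<Longrightarrow> closed {p. P a p}"
  shows "closed {p. \<exists>a\<in>A. P a p}"
  using closed_UN[OF assms(1), of "\<lambda>a. {p. P a p}"] assms(2) by (simp add: Collect_bex_eq)

text \<open>Tychonoff's theorem, stated for the product topology that function types carry.\<close>

lemma compact_PiE_UNIV:
  fixes K :: "'b \<Rightarrow> 'c::topological_space set"
  assumes "\<And>a. compact (K a)"
  shows "compact (Pi\<^sub>E UNIV K)"
  using compactin_PiE[of "\<lambda>_. euclidean" UNIV K] assms
  by (simp add: euclidean_product_topology)

lemma continuous_on_coordinates2:
  assumes "continuous_on S f"
  shows "continuous_on S (\<lambda>p. f p a i)"
  by (rule continuous_on_product_then_coordinatewise[where f="\<lambda>p. f p a"])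
    (rule continuous_on_product_then_coordinatewise[OF assms])

text \<open>All constraints are equations or non-strict inequalities between continuous expressions.
  The grid also depends on the parameter, as it moves with the start times.\<close>

lemma closed_storage_flow:
  assumes "\<And>i. continuous_on UNIV (\<lambda>p. \<theta> p i)"
    and "\<And>a i. continuous_on UNIV (\<lambda>p. x p a i)"
    and "\<And>v i. continuous_on UNIV (\<lambda>p. w p v i)"
  shows "closed {p. storage_flow I m (\<theta> p) (x p) (w p)}"
  unfolding storage_flow_def
  by (intro closed_Collect_conj closed_Collect_ball closed_Collect_le closed_Collect_eq
      continuous_on_sum continuous_on_add continuous_on_mult continuous_on_diff
      continuous_on_const assms)

lemma closed_timed_flow:
  assumes "\<And>a. continuous_on UNIV (\<lambda>p. ts p a)"
    and "\<And>i. continuous_on UNIV (\<lambda>p. \<theta> p i)"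
    and "\<And>a i. continuous_on UNIV (\<lambda>p. x p a i)"
    and "\<And>v i. continuous_on UNIV (\<lambda>p. w p v i)"
  shows "closed {p. timed_flow I (ts p) m (\<theta> p) (x p) (w p)}"
proof -
  have "continuous_on UNIV (\<lambda>p. uptime I (ts p) a (\<theta> p i))" for a i
    unfolding uptime_def
    by (cases "a \<in> job_arcs I")
      (simp_all add: assms continuous_on_diff continuous_on_min continuous_on_max)
  then show ?thesis
    unfolding timed_flow_def
    by (intro closed_Collect_conj closed_storage_flow closed_Collect_ball closed_Collect_le
        continuous_on_mult continuous_on_diff continuous_on_const assms)
qed

text \<open>The index of the grid point at an end of a job ranges over a finite set, so its
  existence is a finite union of closed conditions.\<close>

lemma closed_adapted_grid:
  assumes "\<And>a. continuous_on UNIV (\<lambda>p. ts p a)" "\<And>i. continuous_on UNIV (\<lambda>p. \<theta> p i)"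
  shows "closed {p. adapted_grid I (ts p) m (\<theta> p)}"
  unfolding adapted_grid_def time_grid_def
  by (intro closed_Collect_conj closed_Collect_ball closed_Collect_finite_bex closed_Collect_le
      closed_Collect_eq continuous_on_add continuous_on_const assms finite_atLeastAtMost)

lemma continuous_on_net_outflow:
  assumes "\<And>a i. continuous_on S (\<lambda>p. x p a i)"
  shows "continuous_on S (\<lambda>p. net_outflow I m (x p))"
  unfolding net_outflow_def
  by (intro continuous_on_sum continuous_on_diff assms)

text \<open>Coordinates outside the index ranges are unconstrained and would spoil compactness.
  Setting them to 0 leaves feasibility and value unchanged.\<close>

definition clip_flow ::
  "('v, 'a) maintenance_problem \<Rightarrow> nat \<Rightarrow> ('a \<Rightarrow> nat \<Rightarrow> real) \<Rightarrow> 'a \<Rightarrow> nat \<Rightarrow> real" where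
  "clip_flow I m x a i = (if a \<in> arcs (network I) \<and> i \<in> {1..m} then x a i else 0)"

definition clip_storage ::
  "('v, 'a) maintenance_problem \<Rightarrow> nat \<Rightarrow> ('v \<Rightarrow> nat \<Rightarrow> real) \<Rightarrow> 'v \<Rightarrow> nat \<Rightarrow> real" where
  "clip_storage I m w v i = (if v \<in> storage I \<and> i \<in> {0..m} then w v i else 0)"

text \<open>A full product over both index types, with singleton factors outside the index ranges,
  so that Tychonoff's theorem applies. No interval is longer than the horizon, which gives the bound
  for arcs.\<close>

definition flow_box ::
  "('v, 'a) maintenance_problem \<Rightarrow> nat \<Rightarrow> (('a \<Rightarrow> nat \<Rightarrow> real) \<times> ('v \<Rightarrow> nat \<Rightarrow> real)) set" where
  "flow_box I m =
    (\<Pi>\<^sub>E a\<in>UNIV. \<Pi>\<^sub>E i\<in>UNIV.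
      if a \<in> arcs (network I) \<and> i \<in> {1..m} then {0..horizon I * arc_cap I a} else {0}) \<times>
    (\<Pi>\<^sub>E v\<in>UNIV. \<Pi>\<^sub>E i\<in>UNIV. if v \<in> storage I \<and> i \<in> {0..m} then {0..node_cap I v} else {0})"

lemma compact_flow_box: "compact (flow_box I m)"
  unfolding flow_box_def by (intro compact_Times compact_PiE_UNIV) auto

text \<open>Every constraint reads only coordinates inside the index ranges.\<close>

lemma storage_flow_clip:
  assumes "storage_flow I m \<theta> x w"
  shows "storage_flow I m \<theta> (clip_flow I m x) (clip_storage I m w)"
proof -
  have "(\<Sum>a\<in>A. clip_flow I m x a i) = (\<Sum>a\<in>A. x a i)"
    if "A \<subseteq> arcs (network I)" "i \<in> {1..m}" for A i
    using that by (intro sum.cong) (auto simp: clip_flow_def)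
  moreover have "out_arcs (network I) v \<subseteq> arcs (network I)" "in_arcs (network I) v \<subseteq> arcs (network I)" for v
    by auto
  ultimately show ?thesis
    using assms by (simp add: storage_flow_def clip_storage_def) (auto simp: clip_flow_def)
qed

lemma net_outflow_clip: "net_outflow I m (clip_flow I m x) = net_outflow I m x"
  unfolding net_outflow_def
  by (intro sum.cong arg_cong2[where f="(-)"]) (auto simp: clip_flow_def)

context maintenance_instance
begin

lemma clip_in_flow_box:
  assumes "storage_flow I m \<theta> x w" "time_grid I m \<theta>"
    and "\<And>a i. a \<in> arcs (network I) \<Longrightarrow> i \<in> {1..m} \<Longrightarrow> x a i \<le> (\<theta> i - \<theta> (i - 1)) * arc_cap I a"
  shows "(clip_flow I m x, clip_storage I m w) \<in> flow_box I m"
proof -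
  have "x a i \<le> horizon I * arc_cap I a" if "a \<in> arcs (network I)" "i \<in> {1..m}" for a i
  proof -
    have "\<theta> i - \<theta> (i - 1) \<le> horizon I"
      using time_grid_bounds[OF assms(2), of i]
        time_grid_bounds[OF assms(2), of "i - 1", OF le_trans[OF diff_le_self]] that by auto
    then have "(\<theta> i - \<theta> (i - 1)) * arc_cap I a \<le> horizon I * arc_cap I a"
      by (intro mult_right_mono arc_cap_nonneg that)
    with assms(3)[OF that] show ?thesis by linarith
  qed
  moreover have "0 \<le> x a i" if "a \<in> arcs (network I)" "i \<in> {1..m}" for a i
    using assms(1) that by (simp add: storage_flow_def)
  moreover have "0 \<le> w v i" "w v i \<le> node_cap I v" if "v \<in> storage I" "i \<in> {0..m}" for v i
    using assms(1) that by (simp_all add: storage_flow_def)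
  ultimately show ?thesis
    unfolding flow_box_def by (intro SigmaI PiE_I) (simp_all add: clip_flow_def clip_storage_def)
qed

section \<open>The breakpoints of a schedule as an adapted grid\<close>

lemma finite_breakpoints: "finite (breakpoints I ts)"
  using finite_subset[OF job_arcs_subset finite_arcs] by (simp add: breakpoints_def)

lemma num_intervals_eq: "card (breakpoints I ts) = Suc (num_intervals I ts)"
proof -
  have "breakpoints I ts \<noteq> {}" by (simp add: breakpoints_def)
  then have "card (breakpoints I ts) \<noteq> 0" using finite_breakpoints by simp
  then show ?thesis by (simp add: num_intervals_def)
qed

lemma breakpoint_less:
  assumes "i < j" "j \<le> num_intervals I ts"
  shows "breakpoint I ts i < breakpoint I ts j"
  unfolding breakpoint_def using assms num_intervals_eq[of ts]
  by (intro sorted_wrt_nth_less[OF strict_sorted_list_of_set]) auto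

lemma breakpoint_image: "breakpoint I ts ` {0..num_intervals I ts} = breakpoints I ts"
proof -
  have "breakpoint I ts ` {0..num_intervals I ts} = set (sorted_list_of_set (breakpoints I ts))"
    using num_intervals_eq[of ts] unfolding breakpoint_def set_conv_nth
    by (auto simp: image_iff less_Suc_eq_le)
  then show ?thesis using finite_breakpoints by simp
qed

lemma breakpoints_bounds:
  assumes "ts \<in> start_times I" "b \<in> breakpoints I ts"
  shows "0 \<le> b" "b \<le> horizon I"
proof -
  have "0 \<le> ts a \<and> ts a \<le> horizon I \<and> 0 \<le> ts a + proc_time I a \<and> ts a + proc_time I a \<le> horizon I"
    if "a \<in> job_arcs I" for a
    using start_times_bounds[OF assms(1) that] by linarith
  then show "0 \<le> b" "b \<le> horizon I"
    using assms(2) horizon_pos by (auto simp: breakpoints_def)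
qed

text \<open>The job windows keep all breakpoints between 0 and the horizon, which are breakpoints
  themselves. The sorted enumeration therefore starts and ends there.\<close>

lemma adapted_grid_breakpoint:
  assumes "ts \<in> start_times I"
  shows "adapted_grid I ts (num_intervals I ts) (breakpoint I ts)"
proof -
  let ?N = "num_intervals I ts" and ?b = "breakpoint I ts"
  have mono: "?b i \<le> ?b j" if "i \<le> j" "j \<le> ?N" for i j
    using breakpoint_less[of i j ts] that by (cases "i = j") auto
  have attained: "\<exists>i\<in>{0..?N}. ?b i = c" if "c \<in> breakpoints I ts" for c
    using that unfolding breakpoint_image[symmetric] by auto
  have bounds: "0 \<le> ?b i" "?b i \<le> horizon I" if "i \<le> ?N" for i
    using breakpoints_bounds[OF assms, of "?b i"] that breakpoint_image[of ts] by force+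
  from attained[of 0] obtain i where "i \<in> {0..?N}" "?b i = 0" by (auto simp: breakpoints_def)
  then have "?b 0 = 0" using mono[of 0 i] bounds(1)[of 0] by auto
  moreover from attained[of "horizon I"] obtain j where "j \<in> {0..?N}" "?b j = horizon I"
    by (auto simp: breakpoints_def)
  then have "?b ?N = horizon I" using mono[of j ?N] bounds(2)[of ?N] by auto
  moreover have "?b (i - 1) \<le> ?b i" if "i \<in> {1..?N}" for i
    using that by (intro mono) auto
  ultimately show ?thesis
    using attained by (auto simp: adapted_grid_def time_grid_def breakpoints_def)
qed

text \<open>On the breakpoint grid the increment of \<open>uptime\<close> for a job arc is 0 on its
  outage intervals and the interval length elsewhere. A zero bound together with nonnegativity is
  the equation \<open>x a i = 0\<close>.\<close>

lemma schedule_flow_iff_timed_flow: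
  assumes "ts \<in> start_times I"
  shows "schedule_flow I ts x w \<longleftrightarrow> timed_flow I ts (num_intervals I ts) (breakpoint I ts) x w"
proof -
  let ?N = "num_intervals I ts" and ?b = "breakpoint I ts"
  let ?d = "\<lambda>a i. uptime I ts a (?b i) - uptime I ts a (?b (i - 1))"
  have job: "?d a i = (if i \<in> outage_intervals I ts a then 0 else ?b i - ?b (i - 1))"
    if a: "a \<in> job_arcs I" and i: "i \<in> {1..?N}" for a i
  proof -
    have less: "?b (i - 1) < ?b i" using i by (intro breakpoint_less) auto
    have out: "i \<in> outage_intervals I ts a \<longleftrightarrow> ts a < ?b i \<and> ?b i \<le> ts a + proc_time I a"
      using i by (simp add: outage_intervals_def)
    have "0 < proc_time I a" using a by (rule proc_time_pos)
    with adapted_grid_interval[OF adapted_grid_breakpoint[OF assms] a i] less a show ?thesis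
      unfolding out by (auto simp: uptime_def min_def max_def)
  qed
  have other: "?d a i = ?b i - ?b (i - 1)" if "a \<notin> job_arcs I" for a i
    using that by (simp add: uptime_def)
  have sub: "outage_intervals I ts a \<subseteq> {1..?N}" for a
    by (auto simp: outage_intervals_def)
  show ?thesis
  proof
    assume L: "schedule_flow I ts x w"
    then have flow: "storage_flow I ?N ?b x w" by (simp add: schedule_flow_def)
    have "x a i \<le> ?d a i * arc_cap I a" if "a \<in> arcs (network I)" "i \<in> {1..?N}" for a i
    proof (cases "a \<in> job_arcs I")
      case True
      then show ?thesis using L that job[OF True that(2)] by (auto simp: schedule_flow_def)
    next
      case False
      then show ?thesis unfolding other[OF False] using flow that by (simp add: storage_flow_def)
    qed
    with flow show "timed_flow I ts ?N ?b x w" by (simp add: timed_flow_def)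
  next
    assume R: "timed_flow I ts ?N ?b x w"
    then have flow: "storage_flow I ?N ?b x w" by (simp add: timed_flow_def)
    have cap: "x a i \<le> ?d a i * arc_cap I a" if "a \<in> job_arcs I" "i \<in> {1..?N}" for a i
      using R that job_arcs_subset by (auto simp: timed_flow_def)
    have "x a i = 0" if "a \<in> job_arcs I" "i \<in> outage_intervals I ts a" for a i
    proof -
      have i: "i \<in> {1..?N}" using sub that by blast
      then have "0 \<le> x a i" using flow that job_arcs_subset by (auto simp: storage_flow_def)
      then show ?thesis using cap[OF that(1) i] job[OF that(1) i] that by simp
    qed
    moreover have "x a i \<le> (?b i - ?b (i - 1)) * arc_cap I a"
      if "a \<in> job_arcs I" "i \<in> {1..?N} - outage_intervals I ts a" for a i
      using cap[of a i] job[of a i] that by auto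
    ultimately show "schedule_flow I ts x w"
      using flow by (simp add: schedule_flow_def)
  qed
qed

text \<open>Any adapted grid, even one with repeated points, may replace the breakpoint grid when
  values of a schedule are computed.\<close>

lemma timed_flow_value_in_flow_values:
  assumes "ts \<in> start_times I" "adapted_grid I ts m \<theta>" "timed_flow I ts m \<theta> x w"
  shows "net_outflow I m x \<in> flow_values I ts"
proof -
  have "time_grid I (num_intervals I ts) (breakpoint I ts)"
    using adapted_grid_breakpoint[OF assms(1)] by (simp add: adapted_grid_def)
  from timed_flow_regrid[OF assms(2,3) this] obtain x' w'
    where "timed_flow I ts (num_intervals I ts) (breakpoint I ts) x' w'"
      "net_outflow I (num_intervals I ts) x' = net_outflow I m x" .
  then show ?thesis
    using schedule_flow_iff_timed_flow[OF assms(1)] by (force simp: flow_values_def)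
qed

lemma flow_value_on_grid:
  assumes "ts \<in> start_times I" "v \<in> flow_values I ts" "time_grid I n t"
  obtains x w where "timed_flow I ts n t x w" "net_outflow I n x = v"
proof -
  from assms(2) obtain x w where "schedule_flow I ts x w" "v = net_outflow I (num_intervals I ts) x"
    by (auto simp: flow_values_def)
  then show ?thesis
    using timed_flow_regrid[OF adapted_grid_breakpoint[OF assms(1)] _ assms(3)] that
      schedule_flow_iff_timed_flow[OF assms(1)] by metis
qed

lemma flow_values_nonempty:
  assumes "ts \<in> start_times I"
  shows "flow_values I ts \<noteq> {}"
proof -
  have "timed_flow I ts (num_intervals I ts) (breakpoint I ts) (\<lambda>_ _. 0) (\<lambda>_ _. 0)"
  proof -
    have le: "breakpoint I ts (i - 1) \<le> breakpoint I ts i" if "i \<in> {1..num_intervals I ts}" for i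
      using breakpoint_less[of "i - 1" i ts] that by auto
    then have "uptime I ts a (breakpoint I ts (i - 1)) \<le> uptime I ts a (breakpoint I ts i)"
      if "i \<in> {1..num_intervals I ts}" for a i
      using le[OF that] by (auto simp: uptime_def min_def max_def)
    with le show ?thesis
      by (simp add: timed_flow_def storage_flow_def arc_cap_nonneg node_cap_nonneg)
  qed
  then show ?thesis
    using schedule_flow_iff_timed_flow[OF assms] by (auto simp: flow_values_def)
qed

section \<open>Maximization over compact sets of schedules\<close>

lemma num_intervals_le: "num_intervals I ts \<le> 2 * card (job_arcs I) + 1"
proof -
  have fin: "finite (job_arcs I)" using finite_subset[OF job_arcs_subset finite_arcs] .
  have "card (breakpoints I ts) \<le> card (ts ` job_arcs I) +
    card ((\<lambda>a. ts a + proc_time I a) ` job_arcs I) + card {0, horizon I}"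
    unfolding breakpoints_def by (intro order_trans[OF card_Un_le] add_right_mono) simp
  also have "\<dots> \<le> card (job_arcs I) + card (job_arcs I) + 2"
    using card_image_le[OF fin] by (intro add_mono) (auto simp: card_insert_if)
  finally show ?thesis by (simp add: num_intervals_eq)
qed

text \<open>The number of breakpoints varies with the schedule. Repeating the last one pads all
  grids to a common size, and also keeps the coordinates beyond that size bounded.\<close>

lemma adapted_grid_uniform_size:
  assumes "ts \<in> start_times I"
  obtains \<theta> where "adapted_grid I ts (2 * card (job_arcs I) + 1) \<theta>" "\<And>i. \<theta> i \<in> {0..horizon I}"
proof
  let ?N = "num_intervals I ts" and ?m = "2 * card (job_arcs I) + 1"
  let ?\<theta> = "\<lambda>i. breakpoint I ts (min i ?N)"
  note le = num_intervals_le[of ts]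
  have ad: "adapted_grid I ts ?N (breakpoint I ts)" by (rule adapted_grid_breakpoint[OF assms])
  then have grid: "time_grid I ?N (breakpoint I ts)" by (simp add: adapted_grid_def)
  show "?\<theta> i \<in> {0..horizon I}" for i
    using time_grid_bounds[OF grid, of "min i ?N"] by simp
  have attained: "\<exists>i\<in>{0..?m}. ?\<theta> i = c" if "\<exists>i\<in>{0..?N}. breakpoint I ts i = c" for c
  proof -
    from that obtain i where "i \<in> {0..?N}" "breakpoint I ts i = c" by blast
    with le show ?thesis by (intro bexI[of _ i]) (auto simp: min_absorb1)
  qed
  have "time_grid I ?m ?\<theta>"
    unfolding time_grid_def
  proof (intro conjI ballI)
    show "?\<theta> 0 = 0" using grid by (simp add: time_grid_def)
    show "?\<theta> ?m = horizon I" using grid le by (simp add: time_grid_def min_absorb2)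
    show "?\<theta> (i - 1) \<le> ?\<theta> i" for i
      by (rule time_grid_mono[OF grid]) auto
  qed
  then show "adapted_grid I ts ?m ?\<theta>"
    using ad attained by (simp add: adapted_grid_def)
qed

text \<open>With start times, grid, flow and storage as joint variables, a continuous function is
  maximized over a compact set. The set \<open>K\<close> is a single schedule in the case of
  \<open>val\<close> and all of \<open>start_times I\<close> in the case of
  \<open>opt_value\<close>.\<close>

lemma flow_values_attain_max_on_compact:
  assumes "K \<subseteq> start_times I" "compact K" "K \<noteq> {}"
  obtains ts v where "ts \<in> K" "v \<in> flow_values I ts"
    "\<And>ts' v'. ts' \<in> K \<Longrightarrow> v' \<in> flow_values I ts' \<Longrightarrow> v' \<le> v"
proof -
  let ?m = "2 * card (job_arcs I) + 1"
  define B where "B = K \<times> (\<Pi>\<^sub>E i\<in>(UNIV :: nat set). {0..horizon I}) \<times> flow_box I ?m"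
  define C where "C = {p. adapted_grid I (fst p) ?m (fst (snd p)) \<and>
    timed_flow I (fst p) ?m (fst (snd p)) (fst (snd (snd p))) (snd (snd (snd p)))}"
  let ?val = "\<lambda>p. net_outflow I ?m (fst (snd (snd p)))"
  note coords = continuous_on_product_then_coordinatewise[where f=fst]
    continuous_on_product_then_coordinatewise[where f="\<lambda>p. fst (snd p)"]
    continuous_on_coordinates2[where f="\<lambda>p. fst (snd (snd p))"]
    continuous_on_coordinates2[where f="\<lambda>p. snd (snd (snd p))"]
  have "closed C"
    unfolding C_def
    by (intro closed_Collect_conj closed_adapted_grid closed_timed_flow)
      (rule coords, intro continuous_on_fst continuous_on_snd continuous_on_id)+
  moreover have "compact B"
    unfolding B_def using assms(2)
    by (intro compact_Times compact_PiE_UNIV compact_flow_box) auto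
  ultimately have compact: "compact (B \<inter> C)" by (rule compact_Int_closed[rotated])
  \<comment> \<open>Each value over \<open>K\<close> occurs in the compact set: the flow is moved to
    the padded grid and then clipped.\<close>
  have member: "\<exists>p\<in>B \<inter> C. ?val p = v" if ts: "ts \<in> K" and v: "v \<in> flow_values I ts" for ts v
  proof -
    have st: "ts \<in> start_times I" using ts assms(1) by blast
    obtain \<theta> where \<theta>: "adapted_grid I ts ?m \<theta>" "\<And>i. \<theta> i \<in> {0..horizon I}"
      by (rule adapted_grid_uniform_size[OF st]) (rule that)
    then have grid: "time_grid I ?m \<theta>" by (simp add: adapted_grid_def)
    obtain x w where flow: "timed_flow I ts ?m \<theta> x w" "net_outflow I ?m x = v"
      using flow_value_on_grid[OF st v grid] .
    have "x a i \<le> (\<theta> i - \<theta> (i - 1)) * arc_cap I a" if "a \<in> arcs (network I)" "i \<in> {1..?m}" for a i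
    proof -
      have "\<theta> (i - 1) \<le> \<theta> i" using grid that unfolding time_grid_def by blast
      then have "(uptime I ts a (\<theta> i) - uptime I ts a (\<theta> (i - 1))) * arc_cap I a
        \<le> (\<theta> i - \<theta> (i - 1)) * arc_cap I a"
        by (intro mult_right_mono uptime_increment_le arc_cap_nonneg that)
      moreover have "x a i \<le> (uptime I ts a (\<theta> i) - uptime I ts a (\<theta> (i - 1))) * arc_cap I a"
        using flow(1) that unfolding timed_flow_def by blast
      ultimately show ?thesis by linarith
    qed
    then have "(clip_flow I ?m x, clip_storage I ?m w) \<in> flow_box I ?m"
      using flow(1) grid by (intro clip_in_flow_box) (auto simp: timed_flow_def)
    moreover have "timed_flow I ts ?m \<theta> (clip_flow I ?m x) (clip_storage I ?m w)"
      using flow(1) unfolding timed_flow_def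
      by (auto intro: storage_flow_clip simp: clip_flow_def)
    ultimately show ?thesis
      using ts \<theta> flow(2)
      by (intro bexI[of _ "(ts, \<theta>, clip_flow I ?m x, clip_storage I ?m w)"])
        (auto simp: B_def C_def net_outflow_clip)
  qed
  have "B \<inter> C \<noteq> {}"
    using member flow_values_nonempty assms(1,3) by blast
  moreover have "continuous_on (B \<inter> C) ?val"
    by (intro continuous_on_net_outflow coords continuous_on_fst continuous_on_snd continuous_on_id)
  ultimately obtain p where p: "p \<in> B \<inter> C" "\<forall>q\<in>B \<inter> C. ?val q \<le> ?val p"
    using continuous_attains_sup[OF compact, of ?val] by blast
  show ?thesis
  proof
    show ts: "fst p \<in> K" using p(1) by (auto simp: B_def)
    \<comment> \<open>The grid of the maximizer may differ from its breakpoint grid, but it is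
      adapted, so regridding shows that its value belongs to the schedule.\<close>
    show "?val p \<in> flow_values I (fst p)"
      using p(1) ts assms(1) by (intro timed_flow_value_in_flow_values) (auto simp: C_def)
    show "v' \<le> ?val p" if "ts' \<in> K" "v' \<in> flow_values I ts'" for ts' v'
      using member[OF that] p(2) by blast
  qed
qed

lemma is_maximum_val:
  assumes "ts \<in> start_times I"
  shows "is_maximum (flow_values I ts) (val I ts)"
proof -
  obtain ts' v where "ts' \<in> {ts}" "v \<in> flow_values I ts'"
    "\<And>ts' v'. ts' \<in> {ts} \<Longrightarrow> v' \<in> flow_values I ts' \<Longrightarrow> v' \<le> v"
    using flow_values_attain_max_on_compact[of "{ts}"] assms by auto
  then have "is_maximum (flow_values I ts) v" by (simp add: is_maximum_def)
  then show ?thesis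
    using is_maximum_Greatest[of "flow_values I ts" v] by (simp add: val_def)
qed

text \<open>Off the job arcs a start time vector is \<open>undefined\<close>, which contributes
  singleton factors and makes Tychonoff's theorem applicable.\<close>

lemma start_times_eq_PiE_UNIV:
  "start_times I = (\<Pi>\<^sub>E a\<in>UNIV. if a \<in> job_arcs I
    then {release I a..deadline I a - proc_time I a} else {undefined})"
  unfolding start_times_def by (auto simp: PiE_iff extensional_def split: if_splits)

lemma is_maximum_opt_value: "is_maximum (val I ` start_times I) (opt_value I)"
proof -
  have "compact (start_times I)"
    unfolding start_times_eq_PiE_UNIV by (intro compact_PiE_UNIV) auto
  moreover have "start_times I \<noteq> {}"
    using job_window by (auto simp: start_times_def PiE_eq_empty_iff)
  ultimately obtain ts v where ts: "ts \<in> start_times I" "v \<in> flow_values I ts"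
    "\<And>ts' v'. ts' \<in> start_times I \<Longrightarrow> v' \<in> flow_values I ts' \<Longrightarrow> v' \<le> v"
    using flow_values_attain_max_on_compact[of "start_times I"] by blast
  have "is_maximum (val I ` start_times I) (val I ts)"
    unfolding is_maximum_def
  proof (intro conjI ballI)
    fix u assume "u \<in> val I ` start_times I"
    then obtain ts' where "ts' \<in> start_times I" "u = val I ts'" by blast
    then have "u \<le> v" using ts(3) is_maximum_val[of ts'] by (auto simp: is_maximum_def)
    also have "v \<le> val I ts" using ts(1,2) is_maximum_val[of ts] by (auto simp: is_maximum_def)
    finally show "u \<le> val I ts" .
  qed (use ts(1) in blast)
  then show ?thesis
    using is_maximum_Greatest[of "val I ` start_times I" "val I ts"] by (simp add: opt_value_def)
qed

end

subsection \<open>From schedules to the time discretized program\<close>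

text \<open>For \<open>\<sigma> \<le> \<tau>\<close>, the length of the overlap of the job with the
  interval from \<open>\<sigma>\<close> to \<open>\<tau>\<close>. As an increment of one function it
  telescopes over a grid and complements the increment of \<open>uptime\<close>.\<close>

definition busy_time ::
  "('v, 'a) maintenance_problem \<Rightarrow> ('a \<Rightarrow> real) \<Rightarrow> 'a \<Rightarrow> real \<Rightarrow> real \<Rightarrow> real" where
  "busy_time I ts a \<sigma> \<tau> =
    min (max (\<tau> - ts a) 0) (proc_time I a) - min (max (\<sigma> - ts a) 0) (proc_time I a)"

lemma discretization_less:
  "discretization I n t \<Longrightarrow> i < j \<Longrightarrow> j \<le> n \<Longrightarrow> t i < t j"
  unfolding discretization_def by (auto intro: strict_mono_onD)

lemma discretization_time_grid:
  assumes "discretization I n t"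
  shows "time_grid I n t"
proof -
  have "t (i - 1) \<le> t i" if "i \<in> {1..n}" for i
    using discretization_less[OF assms, of "i - 1" i] that by auto
  then show ?thesis using assms by (simp add: time_grid_def discretization_def)
qed

lemma discretization_interval:
  assumes "discretization I n t" "0 \<le> s" "s < horizon I"
  obtains k where "k \<in> {1..n}" "t (k - 1) \<le> s" "s < t k"
proof
  let ?k = "LEAST i. s < t i"
  have n: "s < t n" using assms by (simp add: discretization_def)
  then have lt: "s < t ?k" by (rule LeastI)
  have "?k \<noteq> 0" using lt assms(1,2) by (metis discretization_def not_less)
  moreover have "?k \<le> n" using n by (rule Least_le)
  ultimately show "?k \<in> {1..n}" by simp
  show "t (?k - 1) \<le> s"
    using not_less_Least[of "?k - 1" "\<lambda>i. s < t i"] \<open>?k \<noteq> 0\<close> by auto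
  show "s < t ?k" by (rule lt)
qed

context maintenance_instance
begin

context
  fixes ts :: "'a \<Rightarrow> real" and n :: nat and t :: "nat \<Rightarrow> real"
  assumes ts: "ts \<in> start_times I" and disc: "discretization I n t"
begin

text \<open>Half-open intervals assign a start at a grid point to the interval on its right, so
  exactly one index is marked.\<close>

definition start_indicator :: "'a \<Rightarrow> nat \<Rightarrow> real" where
  "start_indicator a i = (if t (i - 1) \<le> ts a \<and> ts a < t i then 1 else 0)"

definition busy_fraction :: "'a \<Rightarrow> nat \<Rightarrow> real" where
  "busy_fraction a i = busy_time I ts a (t (i - 1)) (t i) / (t i - t (i - 1))"

lemma step_pos: "i \<in> {1..n} \<Longrightarrow> t (i - 1) < t i"
  by (rule discretization_less[OF disc]) auto

lemma t_le: "i \<le> j \<Longrightarrow> j \<le> n \<Longrightarrow> t i \<le> t j"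
  by (rule time_grid_mono[OF discretization_time_grid[OF disc]])

lemma busy_fraction_eq:
  "i \<in> {1..n} \<Longrightarrow> (t i - t (i - 1)) * busy_fraction a i = busy_time I ts a (t (i - 1)) (t i)"
  using step_pos[of i] by (simp add: busy_fraction_def)

context
  fixes a :: 'a
  assumes job: "a \<in> job_arcs I"
begin

lemmas job_bounds = start_times_bounds[OF ts job]

lemma busy_time_bounds:
  assumes "\<sigma> \<le> \<tau>"
  shows "0 \<le> busy_time I ts a \<sigma> \<tau>" "busy_time I ts a \<sigma> \<tau> \<le> \<tau> - \<sigma>"
  using assms job_bounds(5) by (auto simp: busy_time_def min_def max_def)

text \<open>The job lies between \<open>s\<close> and \<open>e\<close>, so it occupies at most the
  part of the interval between them. The strict hypotheses keep the right-hand side positive even if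
  the job misses the interval.\<close>

lemma busy_time_le_overlap:
  assumes "\<sigma> < \<tau>" "\<sigma> < e" "s < \<tau>" "s \<le> ts a" "ts a + proc_time I a \<le> e"
  shows "busy_time I ts a \<sigma> \<tau> \<le> min \<tau> e - max \<sigma> s"
  using assms job_bounds(5) by (auto simp: busy_time_def min_def max_def)

lemma busy_time_eq_0:
  assumes "\<sigma> \<le> \<tau>" "\<tau> \<le> ts a \<or> ts a + proc_time I a \<le> \<sigma>"
  shows "busy_time I ts a \<sigma> \<tau> = 0"
  using assms job_bounds(5) by (auto simp: busy_time_def min_def max_def)

text \<open>Intervals outside \<open>A\<close> miss the job, so the sum extends to all intervals and
  telescopes to the whole processing time. It is used for both \<open>T_set\<close> and
  \<open>Q_set\<close>.\<close>

lemma sum_busy_time: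
  assumes "A \<subseteq> {1..n}"
    and "\<And>i. i \<in> {1..n} - A \<Longrightarrow> t i \<le> ts a \<or> ts a + proc_time I a \<le> t (i - 1)"
  shows "(\<Sum>i\<in>A. (t i - t (i - 1)) * busy_fraction a i) = proc_time I a"
proof -
  let ?b = "\<lambda>\<tau>. min (max (\<tau> - ts a) 0) (proc_time I a)"
  have "(\<Sum>i\<in>A. (t i - t (i - 1)) * busy_fraction a i) =
    (\<Sum>i\<in>A. busy_time I ts a (t (i - 1)) (t i))"
    using assms(1) by (intro sum.cong refl busy_fraction_eq) auto
  also have "\<dots> = (\<Sum>i=1..n. busy_time I ts a (t (i - 1)) (t i))"
    using assms by (intro sum.mono_neutral_left ballI busy_time_eq_0 t_le) auto
  also have "\<dots> = ?b (t n) - ?b (t 0)"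
    unfolding busy_time_def using sum_telescope''[of 0 n "\<lambda>i. ?b (t i)"] by simp
  also have "\<dots> = proc_time I a"
    using job_bounds disc by (simp add: discretization_def)
  finally show ?thesis .
qed

lemma start_interval:
  obtains k where "k \<in> S_set I n t a" "t (k - 1) \<le> ts a" "ts a < t k"
    "\<And>i. i \<in> {1..n} \<Longrightarrow> start_indicator a i = (if i = k then 1 else 0)"
proof -
  have "0 \<le> ts a" "ts a < horizon I" using job_bounds by linarith+
  from discretization_interval[OF disc this] obtain k
    where k: "k \<in> {1..n}" "t (k - 1) \<le> ts a" "ts a < t k" .
  have "start_indicator a i = (if i = k then 1 else 0)" if "i \<in> {1..n}" for i
  proof (cases i k rule: linorder_cases)
    case less
    then have "t i \<le> t (k - 1)" using k(1) by (intro t_le) auto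
    with less k show ?thesis by (simp add: start_indicator_def)
  next
    case greater
    then have "t k \<le> t (i - 1)" using that by (intro t_le) auto
    with greater k show ?thesis by (simp add: start_indicator_def)
  qed (use k in \<open>simp add: start_indicator_def\<close>)
  moreover have "k \<in> S_set I n t a"
    using k job_bounds by (auto simp: S_set_def)
  ultimately show ?thesis using k that by blast
qed

text \<open>A job that starts before \<open>t k\<close> ends before
  \<open>t k + proc_time I a\<close>, and no later than its deadline; the smaller bound serves as
  \<open>e\<close> in \<open>busy_time_le_overlap\<close>.\<close>

lemma busy_time_le_mu_plus:
  assumes "i \<in> T_set I n t a" "k \<in> P_set I n t a i" "t (k - 1) \<le> ts a" "ts a < t k"
  shows "busy_time I ts a (t (i - 1)) (t i) \<le> mu_plus I t a k i"
proof -
  have "t (i - 1) < t i" using assms(1) by (intro step_pos) (auto simp: T_set_def)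
  moreover have "t (i - 1) < t k + proc_time I a" using assms(2) by (simp add: P_set_def)
  moreover have "t (i - 1) < deadline I a" "release I a < t i" using assms(1) by (auto simp: T_set_def)
  ultimately show ?thesis
    unfolding mu_plus_def using assms(3,4) job_bounds
    by (intro busy_time_le_overlap) auto
qed

text \<open>\<open>mu_minus\<close> describes the least favourable start in interval
  \<open>k\<close>: the latest one if \<open>k = i\<close>, and the earliest one if \<open>k\<close>
  precedes \<open>i\<close>.\<close>

lemma mu_minus_le_busy_time:
  assumes "i \<in> T_set I n t a" "k \<in> P_set I n t a i" "t (k - 1) \<le> ts a" "ts a < t k"
  shows "mu_minus I n t a k i \<le> busy_time I ts a (t (i - 1)) (t i)"
proof -
  have i: "i \<in> {1..n}" using assms(1) by (simp add: T_set_def)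
  have k: "k \<in> {1..n}" "t (k - 1) \<le> t (i - 1)" using assms(2) by (auto simp: P_set_def S_set_def)
  note less = step_pos[OF i]
  show ?thesis
  proof (cases "k = i")
    case True
    have "max 0 (min (t i) (deadline I a) - (deadline I a - proc_time I a))
      \<le> min (t i - ts a) (proc_time I a)"
      using assms(4) job_bounds True by auto
    also have "\<dots> = busy_time I ts a (t (i - 1)) (t i)"
      using assms(3,4) job_bounds(5) True by (simp add: busy_time_def)
    finally show ?thesis using True by (simp add: mu_minus_def)
  next
    case False
    have "\<not> i < k"
    proof
      assume "i < k"
      then have "t i \<le> t (k - 1)" using k(1) by (intro t_le) auto
      with k(2) less show False by linarith
    qed
    then have "t k \<le> t (i - 1)" using False i by (intro t_le) auto
    \<comment> \<open>The job has started by \<open>t (i - 1)\<close>, so only its completion time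
      determines the overlap.\<close>
    then have busy: "busy_time I ts a (t (i - 1)) (t i) =
        max 0 (min (t i) (ts a + proc_time I a) - t (i - 1))"
      using less assms(4) job_bounds(5) by (auto simp: busy_time_def min_def max_def)
    have start: "max (t (k - 1)) (release I a) \<le> ts a" using assms(3) job_bounds(1) by simp
    show ?thesis
    proof (cases "k \<in> P_star I n t a i")
      case True
      \<comment> \<open>Even the earliest start keeps the job running until the end of interval
        \<open>i\<close> or the deadline.\<close>
      then have "min (t i) (deadline I a) \<le> ts a + proc_time I a"
        using start unfolding P_star_def by auto
      then have "min (t i) (deadline I a) \<le> min (t i) (ts a + proc_time I a)" by simp
      then have "min (t i) (deadline I a) - max (t (i - 1)) (release I a)
        \<le> min (t i) (ts a + proc_time I a) - t (i - 1)" by linarith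
      then show ?thesis
        using True False unfolding busy by (simp add: mu_minus_def le_max_iff_disj)
    next
      case not_star: False
      \<comment> \<open>The earliest possible completion lies before \<open>t i\<close>. The actual
        completion is no earlier, so the overlap reaches at least that far.\<close>
      then have "max (t (k - 1)) (release I a) + proc_time I a < t i"
        using assms(2) by (simp add: P_star_def)
      then have "max (t (k - 1)) (release I a) + proc_time I a \<le> min (t i) (ts a + proc_time I a)"
        using start by simp
      then have "max (t (k - 1)) (release I a) + proc_time I a - t (i - 1)
        \<le> max 0 (min (t i) (ts a + proc_time I a) - t (i - 1))" by linarith
      then show ?thesis
        using not_star False unfolding busy by (simp add: mu_minus_def)
    qed
  qed
qed

text \<open>Only the index \<open>k\<close> of the start interval can contribute to the sums. If
  \<open>k\<close> is not in \<open>P_set\<close>, both sums are 0 and the job misses interval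
  \<open>i\<close>.\<close>

lemma busy_time_between_mu_sums:
  assumes "i \<in> T_set I n t a"
  shows "(\<Sum>k\<in>P_set I n t a i. mu_minus I n t a k i * start_indicator a k)
      \<le> busy_time I ts a (t (i - 1)) (t i)"
    and "busy_time I ts a (t (i - 1)) (t i)
      \<le> (\<Sum>k\<in>P_set I n t a i. mu_plus I t a k i * start_indicator a k)"
proof -
  obtain k where k: "k \<in> S_set I n t a" "t (k - 1) \<le> ts a" "ts a < t k"
    and ind: "\<And>i. i \<in> {1..n} \<Longrightarrow> start_indicator a i = (if i = k then 1 else 0)"
    by (rule start_interval) (rule that)
  have i: "i \<in> {1..n}" using assms by (simp add: T_set_def)
  have sub: "P_set I n t a i \<subseteq> {1..n}" by (auto simp: P_set_def S_set_def)
  have sum: "(\<Sum>j\<in>P_set I n t a i. f j * start_indicator a j) =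
    (if k \<in> P_set I n t a i then f k else 0)" for f
  proof -
    have "(\<Sum>j\<in>P_set I n t a i. f j * start_indicator a j) =
      (\<Sum>j\<in>P_set I n t a i. if k = j then f j else 0)"
      using sub ind by (intro sum.cong) auto
    then show ?thesis using finite_subset[OF sub] by (simp add: sum.delta)
  qed
  have zero: "busy_time I ts a (t (i - 1)) (t i) = 0" if "k \<notin> P_set I n t a i"
  proof (rule busy_time_eq_0)
    show "t (i - 1) \<le> t i" using step_pos[OF i] by simp
    \<comment> \<open>Either interval \<open>i\<close> precedes the start interval, or it begins
      after the latest possible completion.\<close>
    have "t (i - 1) < t (k - 1) \<or> t k + proc_time I a \<le> t (i - 1)"
      using that k(1) by (auto simp: P_set_def)
    then show "t i \<le> ts a \<or> ts a + proc_time I a \<le> t (i - 1)"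
    proof
      assume *: "t (i - 1) < t (k - 1)"
      have "i - 1 < k - 1"
      proof (rule ccontr)
        assume "\<not> i - 1 < k - 1"
        then have "t (k - 1) \<le> t (i - 1)" using i by (intro t_le) auto
        with * show False by simp
      qed
      then have "t i \<le> t (k - 1)" using k(1) by (intro t_le) (auto simp: S_set_def)
      with k(2) show ?thesis by simp
    qed (use k(3) in simp)
  qed
  show "(\<Sum>k\<in>P_set I n t a i. mu_minus I n t a k i * start_indicator a k)
      \<le> busy_time I ts a (t (i - 1)) (t i)"
    unfolding sum using zero mu_minus_le_busy_time[OF assms _ k(2,3)] by auto
  show "busy_time I ts a (t (i - 1)) (t i)
      \<le> (\<Sum>k\<in>P_set I n t a i. mu_plus I t a k i * start_indicator a k)"
    unfolding sum using zero busy_time_le_mu_plus[OF assms _ k(2,3)] by auto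
qed

lemma busy_fraction_constraints:
  shows "i \<in> T_set I n t a \<Longrightarrow> busy_fraction a i \<in> {0..1}"
    and "i \<in> T_set I n t a \<Longrightarrow>
      (t i - t (i - 1)) * busy_fraction a i \<le> min (t i) (deadline I a) - max (t (i - 1)) (release I a)"
    and "(\<Sum>i\<in>T_set I n t a. (t i - t (i - 1)) * busy_fraction a i) = proc_time I a"
    and "i \<in> S_set I n t a \<Longrightarrow>
      (\<Sum>k\<in>Q_set I n t a i. (t k - t (k - 1)) * busy_fraction a k) \<ge> proc_time I a * start_indicator a i"
    and "(\<Sum>i\<in>S_set I n t a. start_indicator a i) = 1"
proof -
  have T: "T_set I n t a \<subseteq> {1..n}" by (auto simp: T_set_def)
  have S: "S_set I n t a \<subseteq> {1..n}" by (auto simp: S_set_def)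
  have nonneg: "0 \<le> busy_fraction a i" if "i \<in> {1..n}" for i
    using step_pos[OF that] busy_time_bounds(1)[of "t (i - 1)" "t i"] by (simp add: busy_fraction_def)
  show "busy_fraction a i \<in> {0..1}" if "i \<in> T_set I n t a"
  proof -
    have i: "i \<in> {1..n}" using that T by blast
    then show ?thesis
      using nonneg[OF i] step_pos[OF i] busy_time_bounds(2)[of "t (i - 1)" "t i"]
      by (simp add: busy_fraction_def divide_le_eq)
  qed
  show "(t i - t (i - 1)) * busy_fraction a i \<le> min (t i) (deadline I a) - max (t (i - 1)) (release I a)"
    if "i \<in> T_set I n t a"
  proof -
    have i: "i \<in> {1..n}" using that T by blast
    show ?thesis
      unfolding busy_fraction_eq[OF i] using that step_pos[OF i] job_bounds
      by (intro busy_time_le_overlap) (auto simp: T_set_def)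
  qed
  show "(\<Sum>i\<in>T_set I n t a. (t i - t (i - 1)) * busy_fraction a i) = proc_time I a"
    using T job_bounds by (intro sum_busy_time) (auto simp: T_set_def)
  obtain k where k: "k \<in> S_set I n t a" "t (k - 1) \<le> ts a" "ts a < t k"
    and ind: "\<And>i. i \<in> {1..n} \<Longrightarrow> start_indicator a i = (if i = k then 1 else 0)"
    by (rule start_interval) (rule that)
  have "(\<Sum>i\<in>S_set I n t a. start_indicator a i) = (\<Sum>i\<in>S_set I n t a. if k = i then 1 else 0)"
    using S ind by (intro sum.cong) auto
  then show "(\<Sum>i\<in>S_set I n t a. start_indicator a i) = 1"
    using k(1) finite_subset[OF S] by (simp add: sum.delta)
  show "(\<Sum>k\<in>Q_set I n t a i. (t k - t (k - 1)) * busy_fraction a k) \<ge> proc_time I a * start_indicator a i"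
    if i: "i \<in> S_set I n t a"
  proof (cases "i = k")
    case True
    have "(\<Sum>j\<in>Q_set I n t a k. (t j - t (j - 1)) * busy_fraction a j) = proc_time I a"
    proof (rule sum_busy_time)
      show "Q_set I n t a k \<subseteq> {1..n}" using T by (auto simp: Q_set_def)
      fix j assume j: "j \<in> {1..n} - Q_set I n t a k"
      \<comment> \<open>Each way of falling outside \<open>Q_set\<close> puts the interval entirely
        before or entirely after the job.\<close>
      then consider "deadline I a \<le> t (j - 1)" | "t j \<le> release I a" | "j < k"
        | "t k + proc_time I a \<le> t (j - 1)"
        unfolding Q_set_def T_set_def by force
      then show "t j \<le> ts a \<or> ts a + proc_time I a \<le> t (j - 1)"
      proof cases
        case 3
        then have "t j \<le> t (k - 1)" using k(1) S by (intro t_le) auto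
        then show ?thesis using k(2) by simp
      qed (use k(3) job_bounds in linarith)+
    qed
    with True ind[of i] i S show ?thesis by auto
  next
    case False
    have "0 \<le> (t j - t (j - 1)) * busy_fraction a j" if "j \<in> Q_set I n t a i" for j
    proof -
      have "j \<in> {1..n}" using that T by (auto simp: Q_set_def)
      then show ?thesis using nonneg[of j] step_pos[of j] by (intro mult_nonneg_nonneg) auto
    qed
    moreover have "start_indicator a i = 0" using False ind[of i] i S by auto
    ultimately show ?thesis by (simp add: sum_nonneg)
  qed
qed

end

text \<open>Since \<open>uptime\<close> and \<open>busy_time\<close> are complementary, the capacity
  bound becomes the one with factor \<open>1 - busy_fraction a i\<close>. Outside
  \<open>T_set\<close> the interval misses the job window and the full capacity remains.\<close>

lemma timed_flow_tdip_feasible: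
  assumes "timed_flow I ts n t x w"
  shows "tdip_feasible I n t x w start_indicator busy_fraction"
proof -
  have flow: "storage_flow I n t x w" using assms by (simp add: timed_flow_def)
  have cap: "x a i \<le> (t i - t (i - 1)) * (1 - busy_fraction a i) * arc_cap I a"
    if "a \<in> job_arcs I" "i \<in> {1..n}" for a i
  proof -
    have "uptime I ts a (t i) - uptime I ts a (t (i - 1)) =
      (t i - t (i - 1)) - busy_time I ts a (t (i - 1)) (t i)"
      using that by (simp add: uptime_def busy_time_def)
    also have "\<dots> = (t i - t (i - 1)) * (1 - busy_fraction a i)"
      using busy_fraction_eq[OF that(2), of a] by (simp add: right_diff_distrib)
    finally have "uptime I ts a (t i) - uptime I ts a (t (i - 1)) =
      (t i - t (i - 1)) * (1 - busy_fraction a i)" .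
    moreover have "a \<in> arcs (network I)" using that job_arcs_subset by blast
    ultimately show ?thesis
      using assms that(2) unfolding timed_flow_def by metis
  qed
  have full: "x a i \<le> (t i - t (i - 1)) * arc_cap I a"
    if "a \<in> job_arcs I" "i \<in> {1..n} - T_set I n t a" for a i
  proof -
    have "deadline I a \<le> t (i - 1) \<or> t i \<le> release I a" using that by (auto simp: T_set_def)
    then have "busy_time I ts a (t (i - 1)) (t i) = 0"
      using that start_times_bounds[OF ts that(1)] step_pos[of i]
      by (intro busy_time_eq_0) auto
    then show ?thesis using cap[of a i] that by (simp add: busy_fraction_def)
  qed
  have T: "i \<in> {1..n}" if "i \<in> T_set I n t a" for a i
    using that by (simp add: T_set_def)
  show ?thesis
    unfolding tdip_feasible_def
  proof (intro conjI ballI)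
    fix a i assume a: "a \<in> job_arcs I" and i: "i \<in> T_set I n t a"
    note eq = busy_fraction_eq[OF T[OF i]]
    show "(\<Sum>k\<in>P_set I n t a i. mu_minus I n t a k i * start_indicator a k)
        \<le> (t i - t (i - 1)) * busy_fraction a i"
      and "(t i - t (i - 1)) * busy_fraction a i
        \<le> (\<Sum>k\<in>P_set I n t a i. mu_plus I t a k i * start_indicator a k)"
      using busy_time_between_mu_sums[OF a i] unfolding eq by blast+
    show "x a i \<le> (t i - t (i - 1)) * (1 - busy_fraction a i) * arc_cap I a"
      by (rule cap[OF a T[OF i]])
  next
    show "start_indicator a i \<in> {0, 1}" for a i by (simp add: start_indicator_def)
  qed (use flow full busy_fraction_constraints in blast)+
qed

end

lemma flow_value_in_tdip_values:
  assumes "ts \<in> start_times I" "discretization I n t" "v \<in> flow_values I ts"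
  shows "v \<in> tdip_values I n t"
proof -
  obtain x w where "timed_flow I ts n t x w" "net_outflow I n x = v"
    using flow_value_on_grid[OF assms(1,3) discretization_time_grid[OF assms(2)]] .
  with timed_flow_tdip_feasible[OF assms(1,2)] show ?thesis
    unfolding tdip_values_def by blast
qed

end

subsection \<open>Existence of an optimal solution of the time discretized program\<close>

text \<open>The same box serves \<open>y\<close> and \<open>z\<close>; integrality of
  \<open>y\<close> is left to the closed set of feasible points.\<close>

definition decision_box :: "('a \<Rightarrow> nat set) \<Rightarrow> 'a set \<Rightarrow> ('a \<Rightarrow> nat \<Rightarrow> real) set" where
  "decision_box J A =
    (\<Pi>\<^sub>E a\<in>UNIV. \<Pi>\<^sub>E i\<in>UNIV. if a \<in> A \<and> i \<in> J a then {0..1} else {0})"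

definition clip_decision ::
  "('a \<Rightarrow> nat set) \<Rightarrow> 'a set \<Rightarrow> ('a \<Rightarrow> nat \<Rightarrow> real) \<Rightarrow> 'a \<Rightarrow> nat \<Rightarrow> real" where
  "clip_decision J A y a i = (if a \<in> A \<and> i \<in> J a then y a i else 0)"

lemma compact_decision_box: "compact (decision_box J A)"
  unfolding decision_box_def by (intro compact_PiE_UNIV) auto

lemma clip_decision_in_box:
  assumes "\<And>a i. a \<in> A \<Longrightarrow> i \<in> J a \<Longrightarrow> y a i \<in> {0..1}"
  shows "clip_decision J A y \<in> decision_box J A"
  unfolding decision_box_def using assms by (intro PiE_I) (auto simp: clip_decision_def)

text \<open>The sums over \<open>P_set\<close> and \<open>Q_set\<close> read only indices in
  \<open>S_set\<close> and \<open>T_set\<close>, where clipping changes nothing.\<close>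

lemma tdip_feasible_clip:
  assumes "tdip_feasible I n t x w y z" "job_arcs I \<subseteq> arcs (network I)"
  shows "tdip_feasible I n t (clip_flow I n x) (clip_storage I n w)
    (clip_decision (S_set I n t) (job_arcs I) y) (clip_decision (T_set I n t) (job_arcs I) z)"
proof -
  let ?x = "clip_flow I n x" and ?y = "clip_decision (S_set I n t) (job_arcs I) y"
    and ?z = "clip_decision (T_set I n t) (job_arcs I) z"
  have y: "?y a i = y a i" if "a \<in> job_arcs I" "i \<in> S_set I n t a" for a i
    using that by (simp add: clip_decision_def)
  have z: "?z a i = z a i" if "a \<in> job_arcs I" "i \<in> T_set I n t a" for a i
    using that by (simp add: clip_decision_def)
  have x: "?x a i = x a i" if "a \<in> job_arcs I" "i \<in> T_set I n t a" for a i
    using that assms(2) by (auto simp: clip_flow_def T_set_def)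
  have x_free: "?x a i = x a i" if "a \<in> job_arcs I" "i \<in> {1..n} - T_set I n t a" for a i
    using that assms(2) by (auto simp: clip_flow_def)
  have sum_y: "(\<Sum>i\<in>S_set I n t a. ?y a i) = (\<Sum>i\<in>S_set I n t a. y a i)"
    "(\<Sum>k\<in>P_set I n t a i. f k * ?y a k) = (\<Sum>k\<in>P_set I n t a i. f k * y a k)"
    if "a \<in> job_arcs I" for a i f
    using y[OF that] by (auto intro!: sum.cong simp: P_set_def)
  have sum_z: "(\<Sum>i\<in>T_set I n t a. f i * ?z a i) = (\<Sum>i\<in>T_set I n t a. f i * z a i)"
    "(\<Sum>k\<in>Q_set I n t a i. f k * ?z a k) = (\<Sum>k\<in>Q_set I n t a i. f k * z a k)"
    if "a \<in> job_arcs I" for a i f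
    using z[OF that] by (auto intro!: sum.cong simp: Q_set_def)
  show ?thesis
    using assms(1) storage_flow_clip[of I n t x w]
    unfolding tdip_feasible_def
    by (elim conjE) (intro conjI, simp_all only: x x_free y z sum_y sum_z ball_triv simp_thms cong: ball_cong)
qed

text \<open>Membership in \<open>{0, 1}\<close> unfolds to a disjunction of two equations, so
  integrality is a closed condition too.\<close>

lemma closed_tdip_feasible:
  assumes "\<And>a i. continuous_on UNIV (\<lambda>p. x p a i)"
    and "\<And>v i. continuous_on UNIV (\<lambda>p. w p v i)"
    and "\<And>a i. continuous_on UNIV (\<lambda>p. y p a i)"
    and "\<And>a i. continuous_on UNIV (\<lambda>p. z p a i)"
  shows "closed {p. tdip_feasible I n t (x p) (w p) (y p) (z p)}"
  unfolding tdip_feasible_def insert_iff empty_iff simp_thms atLeastAtMost_iff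
  by (intro closed_Collect_conj closed_Collect_disj closed_Collect_ball closed_Collect_le
      closed_Collect_eq closed_storage_flow continuous_on_sum continuous_on_mult
      continuous_on_diff continuous_on_const assms)

context maintenance_instance
begin

text \<open>Clipping places every feasible value in a compact set of solutions. Nonemptiness is
  supplied later by an optimal schedule.\<close>

lemma is_maximum_tdip_opt:
  assumes "discretization I n t" "tdip_values I n t \<noteq> {}"
  shows "is_maximum (tdip_values I n t) (tdip_opt I n t)"
proof -
  note grid = discretization_time_grid[OF assms(1)]
  let ?S = "S_set I n t" and ?T = "T_set I n t" and ?J = "job_arcs I"
  define B where "B = flow_box I n \<times> decision_box ?S ?J \<times> decision_box ?T ?J"
  define C where "C = {p. tdip_feasible I n t (fst (fst p)) (snd (fst p)) (fst (snd p)) (snd (snd p))}"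
  let ?val = "\<lambda>p. net_outflow I n (fst (fst p))"
  note coords = continuous_on_coordinates2[where f="\<lambda>p. fst (fst p)"]
    continuous_on_coordinates2[where f="\<lambda>p. snd (fst p)"]
    continuous_on_coordinates2[where f="\<lambda>p. fst (snd p)"]
    continuous_on_coordinates2[where f="\<lambda>p. snd (snd p)"]
  have "closed C"
    unfolding C_def
    by (intro closed_tdip_feasible)
      (rule coords, intro continuous_on_fst continuous_on_snd continuous_on_id)+
  moreover have "compact B"
    unfolding B_def by (intro compact_Times compact_flow_box compact_decision_box)
  ultimately have compact: "compact (B \<inter> C)" by (rule compact_Int_closed[rotated])
  have vals: "tdip_values I n t = ?val ` (B \<inter> C)"
  proof (intro equalityI subsetI)
    fix v assume "v \<in> tdip_values I n t"
    then obtain x w y z where feas: "tdip_feasible I n t x w y z" and v: "v = net_outflow I n x"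
      by (auto simp: tdip_values_def)
    let ?p = "((clip_flow I n x, clip_storage I n w), (clip_decision ?S ?J y, clip_decision ?T ?J z))"
    have flow: "storage_flow I n t x w" using feas by (simp add: tdip_feasible_def)
    \<comment> \<open>The box requires the capacity without outages; for job arcs it follows from
      \<open>0 \<le> z a i\<close>.\<close>
    have "x a i \<le> (t i - t (i - 1)) * arc_cap I a"
      if a: "a \<in> arcs (network I)" and i: "i \<in> {1..n}" for a i
    proof (cases "a \<in> ?J \<and> i \<in> ?T a")
      case True
      then have "x a i \<le> (t i - t (i - 1)) * (1 - z a i) * arc_cap I a" "z a i \<in> {0..1}"
        using feas by (auto simp: tdip_feasible_def)
      moreover have "t (i - 1) \<le> t i" using grid i unfolding time_grid_def by blast
      then have "(t i - t (i - 1)) * (1 - z a i) \<le> t i - t (i - 1)"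
        using \<open>z a i \<in> {0..1}\<close> by (intro mult_left_le) auto
      then have "(t i - t (i - 1)) * (1 - z a i) * arc_cap I a \<le> (t i - t (i - 1)) * arc_cap I a"
        by (intro mult_right_mono arc_cap_nonneg a)
      ultimately show ?thesis by linarith
    next
      case False
      then show ?thesis
        using feas flow a i unfolding tdip_feasible_def storage_flow_def by blast
    qed
    then have "(clip_flow I n x, clip_storage I n w) \<in> flow_box I n"
      by (rule clip_in_flow_box[OF flow grid])
    moreover have "y a i \<in> {0..1}" if "a \<in> ?J" "i \<in> ?S a" for a i
    proof -
      have "y a i \<in> {0, 1}" using feas that unfolding tdip_feasible_def by blast
      then show ?thesis by auto
    qed
    then have "clip_decision ?S ?J y \<in> decision_box ?S ?J" by (rule clip_decision_in_box)
    moreover have "z a i \<in> {0..1}" if "a \<in> ?J" "i \<in> ?T a" for a i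
      using feas that unfolding tdip_feasible_def by blast
    then have "clip_decision ?T ?J z \<in> decision_box ?T ?J" by (rule clip_decision_in_box)
    ultimately have "?p \<in> B \<inter> C"
      using tdip_feasible_clip[OF feas job_arcs_subset] by (simp add: B_def C_def)
    moreover have "v = ?val ?p" by (simp add: v net_outflow_clip)
    ultimately show "v \<in> ?val ` (B \<inter> C)" by blast
  next
    fix v assume "v \<in> ?val ` (B \<inter> C)"
    then show "v \<in> tdip_values I n t" by (auto simp: tdip_values_def C_def)
  qed
  have "continuous_on (B \<inter> C) ?val"
    by (intro continuous_on_net_outflow coords continuous_on_fst continuous_on_snd continuous_on_id)
  moreover have "B \<inter> C \<noteq> {}" using assms(2) unfolding vals by blast
  ultimately obtain p where "p \<in> B \<inter> C" "\<forall>q\<in>B \<inter> C. ?val q \<le> ?val p"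
    using continuous_attains_sup[OF compact, of ?val] by blast
  then have "is_maximum (tdip_values I n t) (?val p)"
    unfolding vals is_maximum_def by blast
  then show ?thesis
    using is_maximum_Greatest[of "tdip_values I n t" "?val p"] by (simp add: tdip_opt_def)
qed

end

theorem proposition3:
  fixes I :: "('v, 'a) maintenance_problem"
    and n :: nat
    and t :: "nat \<Rightarrow> real"
  assumes "maintenance_instance I"
    and "discretization I n t"
  shows "(\<forall>ts\<in>start_times I. is_maximum (flow_values I ts) (val I ts)) \<and>
    is_maximum (val I ` start_times I) (opt_value I) \<and>
    is_maximum (tdip_values I n t) (tdip_opt I n t) \<and>
    opt_value I \<le> tdip_opt I n t"
proof -
  interpret maintenance_instance I by (rule assms(1))
  obtain ts where ts: "ts \<in> start_times I" "opt_value I = val I ts"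
    using is_maximum_opt_value by (auto simp: is_maximum_def)
  then have "opt_value I \<in> flow_values I ts"
    using is_maximum_val[of ts] by (simp add: is_maximum_def)
  \<comment> \<open>This membership yields both the feasibility required for a TDIP optimum and the
    final inequality.\<close>
  then have mem: "opt_value I \<in> tdip_values I n t"
    by (rule flow_value_in_tdip_values[OF ts(1) assms(2)])
  then have "is_maximum (tdip_values I n t) (tdip_opt I n t)"
    using is_maximum_tdip_opt[OF assms(2)] by blast
  with mem show ?thesis
    using is_maximum_val is_maximum_opt_value by (auto simp: is_maximum_def)
qed

end
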